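(* Let $n\ge 1$ be an integer and let $\alpha,\beta>0$ be real numbers such that $$\frac{n}{\alpha}+\frac{1}{\beta}\geq 1\quad\text{and}\quad \frac{1}{\alpha}+\frac{n}{\beta}\geq 1.$$ Then there is a (finite) constant $C(n,\alpha,\beta)$, depending only on $n,\alpha,\beta$, such that $$\sup_{\Omega\in\mathcal K}\ \inf_{z\in\mathrm{int}\,\Omega}\Big(\int_{\mathbb S^n}r_z^\alpha \, d\sigma_{\mathbb S^n} \Big)^{\frac{1}{\alpha}}\Big(\int_{\mathbb S^n}(r_z^* )^\beta \, d\sigma_{\mathbb S^n}\Big)^{\frac{1}{\beta}}\leq C(n,\alpha,\beta),$$ where, for $\Omega\in\mathcal K$ and $z\in\mathrm{int}\,\Omega$, $r_z=r_{\Omega,z}$ is the radial function of $\Omega$ with respect to $z$ and $r_z^*$ is the radial function with respect to $z$ of the dual body $\Omega_z^*$.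
   Context: $\mathcal K$ denotes the set of convex bodies in $\mathbb R^{n+1}$, i.e. compact convex subsets of $\mathbb R^{n+1}$ with non-empty interior. $\mathbb S^n\subset\mathbb R^{n+1}$ is the unit sphere and $\sigma_{\mathbb S^n}$ is its standard measure. For $\Omega\in\mathcal K$ and $z\in\mathrm{int}\,\Omega$, the radial function of $\Omega$ with respect to the centre $z$ is $r_z=r_{\Omega,z}:\mathbb S^n\to\mathbb R$, $r_z(x)=\sup\{\lambda>0 : \lambda x+z\in\Omega\}$. The dual body of $\Omega$ with respect to $z$ is $$\Omega_z^*=\{y+z : y\in\mathbb R^{n+1},\ y\cdot(x-z)\le 1\text{ for all }x\in\Omega\},$$ and $r_z^*=r_{\Omega_z^*,z}$ is the radial function of $\Omega_z^*$ with respect to $z$. *)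

theory Defs
  imports "HOL-Analysis.Analysis"
begin

definition convex_bodies :: "'a::euclidean_space set set" where
  "convex_bodies = {\<Omega>. compact \<Omega> \<and> convex \<Omega> \<and> interior \<Omega> \<noteq> {}}"

definition radial :: "'a::euclidean_space set \<Rightarrow> 'a \<Rightarrow> 'a \<Rightarrow> real" where
  "radial \<Omega> z x = Sup {t. t > 0 \<and> t *\<^sub>R x + z \<in> \<Omega>}"

definition dual_body :: "'a::euclidean_space set \<Rightarrow> 'a \<Rightarrow> 'a set" where
  "dual_body \<Omega> z = {y + z | y. \<forall>x\<in>\<Omega>. y \<bullet> (x - z) \<le> 1}"

text \<open>
  The standard (unnormalised) surface measure on the unit sphere: the measure of
  \<open>A\<close> is the dimension of the ambient space times the Lebesgue measure of the cone
  \<open>{t x | 0 < t \<le> 1, x \<in> A}\<close>, see \<open>emeasure_sphere_measure\<close>. The factor makes the polar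
  coordinate formula hold, and gives the total mass \<open>2 * pi\<close> on the unit circle.
\<close>

definition sphere_measure :: "'a::euclidean_space measure" where
  "sphere_measure =
     distr (restrict_space (scale_measure (of_nat DIM('a)) lborel) (cball 0 1 - {0}))
       (restrict_space borel (sphere 0 1)) (\<lambda>x. x /\<^sub>R norm x)"

lemma space_sphere_measure: "space sphere_measure = (sphere 0 1 :: 'a::euclidean_space set)"
  by (simp add: sphere_measure_def space_restrict_space)

lemma sets_sphere_measure:
  "sets (sphere_measure :: 'a::euclidean_space measure) = sets (restrict_space borel (sphere 0 1))"
  by (simp add: sphere_measure_def)

lemma emeasure_sphere_measure:
  fixes A :: "'a::euclidean_space set"
  assumes "A \<in> sets sphere_measure"
  shows "emeasure sphere_measure A =
           of_nat DIM('a) * emeasure lborel {t *\<^sub>R x | t x. 0 < t \<and> t \<le> 1 \<and> x \<in> A}"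
proof -
  let ?B = "cball 0 1 - {0} :: 'a set"
  let ?R = "restrict_space (scale_measure (of_nat DIM('a)) lborel) ?B"
  let ?p = "\<lambda>x::'a. x /\<^sub>R norm x"
  have A: "A \<in> sets (restrict_space borel (sphere 0 1))"
    using assms by (simp add: sets_sphere_measure)
  then have A1: "A \<subseteq> sphere 0 1"
    using sets.sets_into_space by (fastforce simp: space_restrict_space)
  have B: "?B \<in> sets borel" by measurable
  have "?p \<in> borel_measurable borel" by measurable
  then have "?p \<in> borel_measurable ?R"
    by (intro measurable_restrict_space1) (simp add: measurable_def)
  then have m: "?p \<in> ?R \<rightarrow>\<^sub>M restrict_space borel (sphere 0 1)"
    by (intro measurable_restrict_space2) (auto simp: space_restrict_space)
  have eq: "?p -` A \<inter> space ?R = {t *\<^sub>R x | t x. 0 < t \<and> t \<le> 1 \<and> x \<in> A}" (is "_ = ?C")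
  proof (intro equalityI subsetI)
    fix v assume v: "v \<in> ?p -` A \<inter> space ?R"
    then have "v = norm v *\<^sub>R ?p v" "0 < norm v" "norm v \<le> 1" "?p v \<in> A"
      by (auto simp: space_restrict_space)
    then show "v \<in> ?C" by blast
  next
    fix v assume "v \<in> ?C"
    then show "v \<in> ?p -` A \<inter> space ?R"
      using A1 by (auto simp: space_restrict_space)
  qed
  have "emeasure sphere_measure A = emeasure ?R (?p -` A \<inter> space ?R)"
    unfolding sphere_measure_def by (rule emeasure_distr[OF m A])
  also have "\<dots> = emeasure (scale_measure (of_nat DIM('a)) lborel) ?C"
    unfolding eq[symmetric] using B
    by (intro emeasure_restrict_space) (auto simp: space_restrict_space)
  finally show ?thesis by simp
qed

end

theory Submission
  imports Defs
begin

text \<open>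
  Gram--Schmidt with pivoting yields a centre \<open>z\<close>, an orthonormal frame \<open>e\<close> and lengths \<open>a\<close> such that, up to a
  factor depending only on the dimension, \<open>\<Omega> - z\<close> lies in the ellipsoid with half-axes \<open>a b\<close> along \<open>e b\<close> and its
  polar body lies in the polar ellipsoid. So only ellipsoids matter. There the sphere integral of \<open>r\<^sup>\<alpha>\<close> is at most
  a constant times \<open>\<Sum>j. a j powr (\<alpha> - n) * (\<Prod>i\<noteq>j. a i)\<close> when \<open>\<alpha> > n\<close>, and for every \<open>k\<close> at most a constant times
  \<open>a k * (\<Prod>i\<noteq>k. a i powr ((\<beta> - 1) / n))\<close> when the exponent \<open>\<beta>\<close> is between \<open>1\<close> and \<open>n + 1\<close>. If \<open>\<alpha> > n + 1\<close> and
  \<open>n / \<alpha> + 1 / \<beta> = 1\<close>, the first bound for \<open>a\<close> (largest summand \<open>j\<close>) and the second one for \<open>1 / a\<close> (\<open>k = j\<close>) are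
  exactly reciprocal. Duality settles \<open>\<beta> > n + 1\<close>, the volume case \<open>\<alpha> = \<beta> = n + 1\<close> uses the first bound twice, and
  all remaining exponents are smaller than one of these pairs.
\<close>

section \<open>Rotation invariance and one-dimensional integrals\<close>

text \<open>The image measure is translation invariant and agrees with Lebesgue measure on balls
  about 0, because \<open>T\<close> preserves the norm. The uniqueness argument for Haar measure,
  applied with the unit ball as reference set, then identifies the two measures.\<close>

lemma distr_lborel_orthogonal:
  fixes T :: "'a::euclidean_space \<Rightarrow> 'a"
  assumes "orthogonal_transformation T"
  shows "distr lborel borel T = lborel"
proof -
  interpret T: linear T
    using assms by (rule orthogonal_transformation_linear)
  define \<nu> where "\<nu> = distr lborel borel T"
  have T_cont: "continuous_on UNIV T"
    by (rule linear_continuous_on) (rule linear_linear[THEN iffD2, OF T.linear_axioms])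
  have T_meas [measurable]: "T \<in> borel_measurable borel"
    using T_cont by (rule borel_measurable_continuous_onI)
  have sets_nu [measurable_cong, simp]: "sets \<nu> = sets borel"
    and space_nu [simp]: "space \<nu> = UNIV"
    by (simp_all add: \<nu>_def)
  have norm_T: "norm (T x) = norm x" for x
    using assms by (simp add: orthogonal_transformation)
  have vim: "T -` cball 0 r = cball 0 r" for r
    by (auto simp: norm_T)
  have nu_cball: "emeasure \<nu> (cball 0 r) = emeasure lborel (cball (0::'a) r)" for r
    unfolding \<nu>_def by (subst emeasure_distr) (auto simp: vim)
  interpret nu: sigma_finite_measure \<nu>
  proof
    have "x \<in> (\<Union>n::nat. cball 0 (real n))" for x :: 'a
      using real_arch_simple[of "norm x"] by auto
    then show "\<exists>A. countable A \<and> A \<subseteq> sets \<nu> \<and> \<Union>A = space \<nu> \<and> (\<forall>a\<in>A. emeasure \<nu> a \<noteq> \<infinity>)"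
      by (intro exI[of _ "range (\<lambda>n::nat. cball 0 (real n))"])
        (use emeasure_lborel_cball_finite[of "0::'a"] in \<open>auto simp: nu_cball less_top\<close>)
  qed
  interpret pair_sigma_finite \<nu> lborel ..
  \<comment> \<open>A shift by \<open>a = T b\<close> of the image pulls back to a shift by
    \<open>b\<close>, under which \<open>lborel\<close> is invariant; surjectivity of
    \<open>T\<close> supplies \<open>b\<close>.\<close>
  have nu_shift: "(\<integral>\<^sup>+x. f (x + a) \<partial>\<nu>) = (\<integral>\<^sup>+x. f x \<partial>\<nu>)"
    if [measurable]: "f \<in> borel_measurable borel" for f and a
  proof -
    obtain b where b: "a = T b"
      using orthogonal_transformation_surj[OF assms] by (metis surjD)
    have "(\<integral>\<^sup>+x. f (x + a) \<partial>\<nu>) = (\<integral>\<^sup>+x. f (T (b + x)) \<partial>lborel)"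
      unfolding \<nu>_def by (subst nn_integral_distr) (auto simp: b T.add ac_simps)
    also have "\<dots> = (\<integral>\<^sup>+x. f (T x) \<partial>distr lborel borel ((+) b))"
      by (subst nn_integral_distr) auto
    also have "\<dots> = (\<integral>\<^sup>+x. f x \<partial>\<nu>)"
      unfolding lborel_distr_plus \<nu>_def by (subst nn_integral_distr) auto
    finally show ?thesis .
  qed
  define B where "B = cball (0::'a) 1"
  have [measurable]: "B \<in> sets borel"
    by (simp add: B_def)
  have "emeasure \<nu> A = emeasure lborel A" if [measurable]: "A \<in> sets borel" for A
  proof -
    have shift: "(\<integral>\<^sup>+y. indicator B (x + y) \<partial>lborel) = emeasure lborel B" for x
    proof -
      have "(\<integral>\<^sup>+y. indicator B (x + y) \<partial>lborel) = (\<integral>\<^sup>+y. indicator B y \<partial>distr lborel borel ((+) x))"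
        by (subst nn_integral_distr) auto
      then show ?thesis
        by (simp add: lborel_distr_plus)
    qed
    have reflect: "(\<integral>\<^sup>+y. indicator A (x - y) \<partial>lborel) = emeasure lborel A" for x
    proof -
      have "distr lborel borel (\<lambda>y. x - y) = (lborel :: 'a measure)"
        using lborel_affine[of "-1" x] by (simp add: density_1)
      then have "(\<integral>\<^sup>+y. indicator A y \<partial>lborel) = (\<integral>\<^sup>+y. indicator A y \<partial>distr lborel borel (\<lambda>y. x - y))"
        by simp
      also have "\<dots> = (\<integral>\<^sup>+y. indicator A (x - y) \<partial>lborel)"
        by (subst nn_integral_distr) auto
      finally show ?thesis
        by simp
    qed
    \<comment> \<open>The double integral of \<open>indicator A x * indicator B (x + y)\<close> is
      evaluated in both orders, giving \<nu>(A) |B| = |A| \<nu>(B) with |.| for Lebesgue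
      measure.\<close>
    have "emeasure \<nu> A * emeasure lborel B =
        (\<integral>\<^sup>+x. indicator A x * (\<integral>\<^sup>+y. indicator B (x + y) \<partial>lborel) \<partial>\<nu>)"
      unfolding shift by (subst nn_integral_multc) auto
    also have "\<dots> = (\<integral>\<^sup>+x. (\<integral>\<^sup>+y. indicator A x * indicator B (x + y) \<partial>lborel) \<partial>\<nu>)"
      by (subst nn_integral_cmult[symmetric]) auto
    also have "\<dots> = (\<integral>\<^sup>+y. (\<integral>\<^sup>+x. indicator A x * indicator B (x + y) \<partial>\<nu>) \<partial>lborel)"
      by (rule Fubini'[symmetric]) measurable
    \<comment> \<open>Invariance of \<nu> moves the shift from \<open>B\<close> to \<open>A\<close>,
      so that integrating over \<open>y\<close> first produces the Lebesgue measure of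
      \<open>A\<close> by reflection.\<close>
    also have "\<dots> = (\<integral>\<^sup>+y. (\<integral>\<^sup>+x. indicator A (x - y) * indicator B x \<partial>\<nu>) \<partial>lborel)"
    proof (rule nn_integral_cong)
      fix y :: 'a
      show "(\<integral>\<^sup>+x. indicator A x * indicator B (x + y) \<partial>\<nu>) =
          (\<integral>\<^sup>+x. indicator A (x - y) * indicator B x \<partial>\<nu>)"
        using nu_shift[of "\<lambda>x. indicator A (x - y) * indicator B x" y] by simp
    qed
    also have "\<dots> = (\<integral>\<^sup>+x. (\<integral>\<^sup>+y. indicator A (x - y) * indicator B x \<partial>lborel) \<partial>\<nu>)"
      by (rule Fubini') measurable
    also have "\<dots> = (\<integral>\<^sup>+x. emeasure lborel A * indicator B x \<partial>\<nu>)"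
      by (subst nn_integral_multc) (auto simp: reflect)
    also have "\<dots> = emeasure lborel A * emeasure \<nu> B"
      by (subst nn_integral_cmult) auto
    also have "emeasure \<nu> B = emeasure lborel B"
      unfolding B_def by (rule nu_cball)
    finally have "emeasure \<nu> A * emeasure lborel B = emeasure lborel A * emeasure lborel B" .
    moreover have "emeasure lborel B \<noteq> 0"
      using emeasure_cball[of 1 "0::'a"] less_imp_neq[OF unit_ball_vol_pos[OF of_nat_0_le_iff[of "DIM('a)"]]]
      by (simp add: B_def)
    moreover have "emeasure lborel B \<noteq> \<infinity>"
      using emeasure_lborel_cball_finite[of "0::'a" 1] by (simp add: B_def less_top)
    ultimately show ?thesis
      by (simp add: mult.commute[of _ "emeasure lborel B"] ennreal_mult_cancel_left)
  qed
  then show ?thesis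
    unfolding \<nu>_def[symmetric] by (intro measure_eqI) auto
qed

section \<open>Power integrals and the Cauchy kernel on the real line\<close>

lemma nn_integral_even_le:
  fixes f :: "real \<Rightarrow> ennreal"
  assumes [measurable]: "f \<in> borel_measurable borel"
    and even: "\<And>x. f (- x) = f x"
  shows "(\<integral>\<^sup>+x. f x \<partial>lborel) \<le> 2 * (\<integral>\<^sup>+x. f x * indicator {0..} x \<partial>lborel)"
proof -
  \<comment> \<open>The two closed half-lines share the point 0, which is counted twice; this is
    harmless for an upper bound.\<close>
  have "(\<integral>\<^sup>+x. f x \<partial>lborel) \<le> (\<integral>\<^sup>+x. f x * indicator {0..} x + f x * indicator {..0} x \<partial>lborel)"
    by (intro nn_integral_mono) (auto simp: indicator_def)
  also have "\<dots> = (\<integral>\<^sup>+x. f x * indicator {0..} x \<partial>lborel) + (\<integral>\<^sup>+x. f x * indicator {..0} x \<partial>lborel)"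
    by (rule nn_integral_add) auto
  also have "(\<integral>\<^sup>+x. f x * indicator {..0} x \<partial>lborel) = (\<integral>\<^sup>+x. f x * indicator {0..} x \<partial>lborel)"
    by (subst nn_integral_real_affine[where c = "-1" and t = 0])
      (auto simp: even indicator_def intro!: nn_integral_cong)
  finally show ?thesis
    by (simp add: mult_2)
qed

lemma nn_integral_abs_powr_le:
  fixes \<kappa> :: real
  assumes "\<kappa> < 1"
  shows "(\<integral>\<^sup>+x. ennreal (\<bar>x\<bar> powr - \<kappa>) * indicator {-1..1} x \<partial>lborel) \<le> ennreal (2 / (1 - \<kappa>))"
proof -
  have "(\<integral>\<^sup>+x. ennreal (\<bar>x\<bar> powr - \<kappa>) * indicator {-1..1} x \<partial>lborel) \<le>
      2 * (\<integral>\<^sup>+x. ennreal (\<bar>x\<bar> powr - \<kappa>) * indicator {-1..1} x * indicator {0..} x \<partial>lborel)"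
    by (rule nn_integral_even_le) (auto simp: indicator_def)
  also have "(\<integral>\<^sup>+x. ennreal (\<bar>x\<bar> powr - \<kappa>) * indicator {-1..1} x * indicator {0..} x \<partial>lborel) =
      (\<integral>\<^sup>+x. indicator {0..1} x * ennreal (x powr - \<kappa>) \<partial>lborel)"
    by (intro nn_integral_cong) (auto simp: indicator_def)
  also have "\<dots> = ennreal (1 powr (- \<kappa> + 1) / (- \<kappa> + 1))"
    using nn_integral_has_integral_lebesgue[OF _ has_integral_powr_from_0[of "-\<kappa>" 1]] assms
    by (simp add: ennreal_mult' ennreal_indicator)
  also have "2 * \<dots> = ennreal (2 / (1 - \<kappa>))"
    using assms by (simp add: ennreal_mult'[symmetric] flip: ennreal_numeral)
  finally show ?thesis .
qed

lemma nn_integral_inverse_quadratic_finite: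
  fixes \<gamma> :: real
  assumes "\<gamma> > 1"
  shows "(\<integral>\<^sup>+x. ennreal ((1 + x\<^sup>2) powr - (\<gamma> / 2)) \<partial>lborel) < \<infinity>"
proof -
  have "(\<integral>\<^sup>+x. ennreal ((1 + x\<^sup>2) powr - (\<gamma> / 2)) \<partial>lborel) \<le>
      2 * (\<integral>\<^sup>+x. ennreal ((1 + x\<^sup>2) powr - (\<gamma> / 2)) * indicator {0..} x \<partial>lborel)"
    by (rule nn_integral_even_le) auto
  also have "(\<integral>\<^sup>+x. ennreal ((1 + x\<^sup>2) powr - (\<gamma> / 2)) * indicator {0..} x \<partial>lborel) \<le>
      (\<integral>\<^sup>+x. indicator {0..<1} x + indicator {1..} x * ennreal (x powr - \<gamma>) \<partial>lborel)"
  proof (intro nn_integral_mono)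
    fix x :: real
    have "(1 + x\<^sup>2) powr - (\<gamma> / 2) \<le> 1"
      using assms powr_mono2'[of "- (\<gamma> / 2)" 1 "1 + x\<^sup>2"] by simp
    moreover have "(1 + x\<^sup>2) powr - (\<gamma> / 2) \<le> x powr - \<gamma>" if "x \<ge> 1"
    proof -
      have "(1 + x\<^sup>2) powr - (\<gamma> / 2) \<le> (x\<^sup>2) powr - (\<gamma> / 2)"
        using that assms by (intro powr_mono2') auto
      also have "\<dots> = x powr - \<gamma>"
        using that by (simp add: powr_powr flip: powr_numeral)
      finally show ?thesis .
    qed
    ultimately show "ennreal ((1 + x\<^sup>2) powr - (\<gamma> / 2)) * indicator {0..} x \<le>
        indicator {0..<1} x + indicator {1..} x * ennreal (x powr - \<gamma>)"
      by (auto simp: indicator_def ennreal_le_1 intro: ennreal_leI)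
  qed
  also have "\<dots> = emeasure lborel {0..<1::real} + (\<integral>\<^sup>+x. indicator {1..} x * ennreal (x powr - \<gamma>) \<partial>lborel)"
    by (subst nn_integral_add) auto
  also have "(\<integral>\<^sup>+x. indicator {1..} x * ennreal (x powr - \<gamma>) \<partial>lborel) =
      ennreal (- (1 powr (- \<gamma> + 1)) / (- \<gamma> + 1))"
    using nn_integral_has_integral_lebesgue[OF _ has_integral_powr_to_inf[of "-\<gamma>" 1]] assms
    by (simp add: ennreal_mult' ennreal_indicator)
  finally show ?thesis
    by (simp add: mult_left_mono order.strict_trans1 ennreal_mult_less_top)
qed

text \<open>For \<gamma> > 1 this is the Beta integral with value sqrt(pi) Gamma((\<gamma> - 1)/2) /
  Gamma(\<gamma>/2). Only its finiteness and sign matter below, and \<open>enn2real\<close> makes it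
  a nonnegative real for every \<gamma>.\<close>

definition cauchy_const :: "real \<Rightarrow> real" where
  "cauchy_const \<gamma> = enn2real (\<integral>\<^sup>+x. ennreal ((1 + x\<^sup>2) powr - (\<gamma> / 2)) \<partial>lborel)"

text \<open>Substituting \<open>b * s * x\<close> for \<open>x\<close> pulls out
  \<open>s powr - \<gamma>\<close> from the kernel and \<open>b * s\<close> from the measure. Both
  slicing arguments below integrate out coordinates with this formula.\<close>

lemma nn_integral_cauchy_kernel:
  fixes \<gamma> s b :: real
  assumes "\<gamma> > 1" "s > 0" "b > 0"
  shows "(\<integral>\<^sup>+x. ennreal ((s\<^sup>2 + (x / b)\<^sup>2) powr - (\<gamma> / 2)) \<partial>lborel) =
    ennreal (cauchy_const \<gamma> * b * s powr (1 - \<gamma>))"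
proof -
  have "(\<integral>\<^sup>+x. ennreal ((s\<^sup>2 + (x / b)\<^sup>2) powr - (\<gamma> / 2)) \<partial>lborel) =
      ennreal (b * s) * (\<integral>\<^sup>+x. ennreal ((s\<^sup>2 + (b * s * x / b)\<^sup>2) powr - (\<gamma> / 2)) \<partial>lborel)"
    using assms by (subst nn_integral_real_affine[where c = "b * s" and t = 0]) auto
  also have "(\<integral>\<^sup>+x. ennreal ((s\<^sup>2 + (b * s * x / b)\<^sup>2) powr - (\<gamma> / 2)) \<partial>lborel) =
      (\<integral>\<^sup>+x. ennreal (s powr - \<gamma>) * ennreal ((1 + x\<^sup>2) powr - (\<gamma> / 2)) \<partial>lborel)"
  proof (intro nn_integral_cong)
    fix x :: real
    have "s\<^sup>2 + (b * s * x / b)\<^sup>2 = s\<^sup>2 * (1 + x\<^sup>2)"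
      using assms by (simp add: power2_eq_square algebra_simps)
    then have "(s\<^sup>2 + (b * s * x / b)\<^sup>2) powr - (\<gamma> / 2) = (s\<^sup>2) powr - (\<gamma> / 2) * (1 + x\<^sup>2) powr - (\<gamma> / 2)"
      by (simp add: powr_mult)
    also have "(s\<^sup>2) powr - (\<gamma> / 2) = s powr - \<gamma>"
      using assms by (simp add: powr_powr flip: powr_numeral)
    finally show "ennreal ((s\<^sup>2 + (b * s * x / b)\<^sup>2) powr - (\<gamma> / 2)) =
        ennreal (s powr - \<gamma>) * ennreal ((1 + x\<^sup>2) powr - (\<gamma> / 2))"
      by (simp add: ennreal_mult')
  qed
  also have "\<dots> = ennreal (s powr - \<gamma>) * ennreal (cauchy_const \<gamma>)"
    using nn_integral_inverse_quadratic_finite[OF assms(1)]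
    by (subst nn_integral_cmult) (auto simp: cauchy_const_def)
  also have "ennreal (b * s) * (ennreal (s powr - \<gamma>) * ennreal (cauchy_const \<gamma>)) =
      ennreal (b * s * (s powr - \<gamma> * cauchy_const \<gamma>))"
    using assms by (simp add: ennreal_mult cauchy_const_def)
  also have "b * s * (s powr - \<gamma> * cauchy_const \<gamma>) = cauchy_const \<gamma> * b * s powr (1 - \<gamma>)"
    using assms by (simp add: powr_diff powr_minus divide_simps)
  finally show ?thesis .
qed

lemma cauchy_const_nonneg: "0 \<le> cauchy_const \<gamma>"
  by (simp add: cauchy_const_def)

section \<open>Integrals over the ball of an ellipsoid\<close>

text \<open>Coordinates are functions on an index set rather than vectors, so that Fubini on
  \<open>PiM\<close> can split off one coordinate. Half-axes equal to 1 give the squared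
  norm.\<close>

definition ellipsoid_form :: "'i set \<Rightarrow> ('i \<Rightarrow> real) \<Rightarrow> ('i \<Rightarrow> real) \<Rightarrow> real" where
  "ellipsoid_form I a f = (\<Sum>i\<in>I. (f i / a i)\<^sup>2)"

text \<open>The ellipsoid with half-axes \<open>a\<close> has radial function |y| / sqrt(Q(y)) in
  the direction of y, where Q is its form. This is therefore the 0-homogeneous extension of the p-th
  power of that radial function, cut off to the punctured unit ball.\<close>

definition ball_integrand :: "'i set \<Rightarrow> ('i \<Rightarrow> real) \<Rightarrow> real \<Rightarrow> ('i \<Rightarrow> real) \<Rightarrow> ennreal" where
  "ball_integrand I a p f =
     ennreal ((ellipsoid_form I (\<lambda>_. 1) f / ellipsoid_form I a f) powr (p / 2)) *
     indicator {f. 0 < ellipsoid_form I (\<lambda>_. 1) f \<and> ellipsoid_form I (\<lambda>_. 1) f \<le> 1} f"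

lemma measurable_ellipsoid_form [measurable]:
  "ellipsoid_form I a \<in> borel_measurable (PiM I (\<lambda>_. lborel))"
  unfolding ellipsoid_form_def by measurable

lemma measurable_ball_integrand [measurable]:
  "ball_integrand I a p \<in> borel_measurable (PiM I (\<lambda>_. lborel))"
  unfolding ball_integrand_def by measurable

lemma ellipsoid_form_nonneg: "0 \<le> ellipsoid_form I a f"
  by (auto simp: ellipsoid_form_def intro: sum_nonneg)

lemma component_le_ellipsoid_form:
  assumes "finite I" "i \<in> I"
  shows "(f i / a i)\<^sup>2 \<le> ellipsoid_form I a f"
  unfolding ellipsoid_form_def using assms by (intro member_le_sum) auto

lemma two_components_le_ellipsoid_form:
  assumes "finite I" "i \<in> I" "j \<in> I" "i \<noteq> j"
  shows "(f j / a j)\<^sup>2 + (f i / a i)\<^sup>2 \<le> ellipsoid_form I a f"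
proof -
  have "(\<Sum>i\<in>{i, j}. (f i / a i)\<^sup>2) \<le> (\<Sum>i\<in>I. (f i / a i)\<^sup>2)"
    using assms by (intro sum_mono2) auto
  then show ?thesis
    using assms by (simp add: ellipsoid_form_def add.commute)
qed

section \<open>Upper bounds for the ball integral at a single exponent\<close>

lemma powr_eq_prod_powr:
  fixes x p :: real
  assumes "finite J" "card J = n" "n \<noteq> 0" "x > 0"
  shows "x powr p = (\<Prod>i\<in>J. x powr (p / real n))"
proof -
  have "(\<Prod>i\<in>J. x powr (p / real n)) = (x powr (p / real n)) ^ n"
    using assms by simp
  also have "\<dots> = x powr (p / real n * real n)"
    using assms by (simp add: powr_realpow[symmetric] powr_powr)
  finally show ?thesis
    using assms by simp
qed

text \<open>Let \<open>j\<close> be a coordinate of largest modulus. The squared norm is at most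
  \<open>n + 1\<close> times the square of \<open>f j\<close>, and the negative power of the form is
  distributed over the other \<open>n\<close> coordinates, the factor of \<open>i\<close> keeping
  only the terms of \<open>i\<close> and \<open>j\<close>. Thus the bound separates in the
  coordinates other than \<open>j\<close>. Summing over all \<open>j\<close> removes the dependence
  of the pivot on \<open>f\<close>.\<close>

lemma ball_integrand_le_sum:
  fixes \<alpha> :: real
  assumes I: "finite I" "card I = n + 1" "n \<ge> 1" and "\<alpha> > 0"
    and a: "\<And>i. i \<in> I \<Longrightarrow> a i > 0"
  shows "ball_integrand I a \<alpha> f \<le> (\<Sum>j\<in>I. ennreal (real (n + 1) powr (\<alpha> / 2)) *
    (ennreal (\<bar>f j\<bar> powr \<alpha>) * indicator {-1..1} (f j) *
     (\<Prod>i\<in>I - {j}. ennreal (((\<bar>f j\<bar> / a j)\<^sup>2 + (f i / a i)\<^sup>2) powr - (\<alpha> / real n / 2)))))"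
    (is "_ \<le> (\<Sum>j\<in>I. ?c * (?F j))")
proof (cases "0 < ellipsoid_form I (\<lambda>_. 1) f \<and> ellipsoid_form I (\<lambda>_. 1) f \<le> 1")
  case True
  let ?q = "ellipsoid_form I (\<lambda>_. 1) f" and ?Q = "ellipsoid_form I a f"
  have "I \<noteq> {}"
    using I by auto
  then obtain j where j: "j \<in> I" and j_max: "\<And>i. i \<in> I \<Longrightarrow> \<bar>f i\<bar> \<le> \<bar>f j\<bar>"
    using I obtains_MAX[of I "\<lambda>i. \<bar>f i\<bar>"] by (metis Max_ge finite_imageI imageI)
  have "?q \<le> (\<Sum>i\<in>I. (f j)\<^sup>2)"
    unfolding ellipsoid_form_def using j_max by (intro sum_mono) (simp add: abs_le_square_iff)
  then have q_le: "?q \<le> real (n + 1) * (f j)\<^sup>2"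
    using I by simp
  then have fj: "f j \<noteq> 0"
    using True by auto
  have "(f j)\<^sup>2 \<le> 1"
    using component_le_ellipsoid_form[OF I(1) j, of f "\<lambda>_. 1"] True by simp
  then have fj1: "f j \<in> {-1..1}"
    by (simp add: abs_square_le_1 abs_le_iff)
  have J: "finite (I - {j})" "card (I - {j}) = n"
    using I j by auto
  have "(f j / a j)\<^sup>2 > 0"
    using fj a[OF j] by simp
  then have Q: "?Q > 0"
    using component_le_ellipsoid_form[OF I(1) j, of f a] by linarith
  have "(?q / ?Q) powr (\<alpha> / 2) = ?q powr (\<alpha> / 2) * ?Q powr - (\<alpha> / 2)"
    using True Q by (simp add: powr_divide powr_minus divide_simps)
  also have "\<dots> \<le> (real (n + 1) * (f j)\<^sup>2) powr (\<alpha> / 2) * ?Q powr - (\<alpha> / 2)"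
    using q_le True \<open>\<alpha> > 0\<close> by (intro mult_right_mono powr_mono2) auto
  also have "(real (n + 1) * (f j)\<^sup>2) powr (\<alpha> / 2) = real (n + 1) powr (\<alpha> / 2) * \<bar>f j\<bar> powr \<alpha>"
  proof -
    have "(f j)\<^sup>2 = \<bar>f j\<bar> powr 2"
      using fj by (simp add: powr_numeral)
    then have "((f j)\<^sup>2) powr (\<alpha> / 2) = \<bar>f j\<bar> powr \<alpha>"
      by (simp only: powr_powr) simp
    then show ?thesis
      by (simp add: powr_mult)
  qed
  also have "?Q powr - (\<alpha> / 2) = (\<Prod>i\<in>I - {j}. ?Q powr - (\<alpha> / real n / 2))"
    using powr_eq_prod_powr[OF J _ Q, of "- (\<alpha> / 2)"] I by (simp add: field_simps)
  also have "real (n + 1) powr (\<alpha> / 2) * \<bar>f j\<bar> powr \<alpha> * \<dots> \<le> real (n + 1) powr (\<alpha> / 2) * \<bar>f j\<bar> powr \<alpha> *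
      (\<Prod>i\<in>I - {j}. ((\<bar>f j\<bar> / a j)\<^sup>2 + (f i / a i)\<^sup>2) powr - (\<alpha> / real n / 2))"
  proof (intro mult_left_mono prod_mono conjI powr_mono2')
    fix i assume i: "i \<in> I - {j}"
    show "(\<bar>f j\<bar> / a j)\<^sup>2 + (f i / a i)\<^sup>2 \<le> ?Q"
      using two_components_le_ellipsoid_form[OF I(1) _ j, of i f a] i by (simp add: power_divide)
    show "0 < (\<bar>f j\<bar> / a j)\<^sup>2 + (f i / a i)\<^sup>2"
      using fj a[OF j] by (intro add_pos_nonneg) auto
  qed (use \<open>\<alpha> > 0\<close> in auto)
  finally have "ball_integrand I a \<alpha> f \<le> ?c * ?F j"
    using True fj1 by (simp add: ball_integrand_def prod_ennreal ennreal_mult'[symmetric] prod_nonneg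
        ennreal_leI mult.assoc)
  also have "\<dots> \<le> (\<Sum>j\<in>I. ?c * (?F j))"
    using I j by (intro member_le_sum) auto
  finally show ?thesis .
qed (simp add: ball_integrand_def)

text \<open>With the pivot coordinate \<open>y\<close> fixed, the other coordinates give
  \<open>n\<close> separate Cauchy kernels of exponent \<alpha>/n, convergent because \<alpha> > n.
  What remains is a multiple of |y|^n, bounded on [-1, 1].\<close>

proposition nn_integral_ball_integrand_le_sum:
  fixes \<alpha> :: real
  assumes I: "finite I" "card I = n + 1" "n \<ge> 1" and \<alpha>: "\<alpha> > real n"
    and a: "\<And>i. i \<in> I \<Longrightarrow> a i > 0"
  shows "(\<integral>\<^sup>+f. ball_integrand I a \<alpha> f \<partial>PiM I (\<lambda>_. lborel)) \<le>
    ennreal (\<Sum>j\<in>I. real (n + 1) powr (\<alpha> / 2) * (2 * cauchy_const (\<alpha> / real n) ^ n) *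
      (a j powr (\<alpha> - real n) * (\<Prod>i\<in>I - {j}. a i)))"
proof -
  interpret product_sigma_finite "\<lambda>_. lborel :: real measure" ..
  define K where "K = cauchy_const (\<alpha> / real n)"
  define F where "F j f = ennreal (\<bar>f j\<bar> powr \<alpha>) * indicator {-1..1} (f j) *
     (\<Prod>i\<in>I - {j}. ennreal (((\<bar>f j\<bar> / a j)\<^sup>2 + (f i / a i)\<^sup>2) powr - (\<alpha> / real n / 2)))" for j f
  have F_meas [measurable]: "F j \<in> borel_measurable (PiM I (\<lambda>_. lborel))" if "j \<in> I" for j
    unfolding F_def using that by measurable
  have F_int: "(\<integral>\<^sup>+f. F j f \<partial>PiM I (\<lambda>_. lborel)) \<le>
      ennreal (2 * K ^ n * (a j powr (\<alpha> - real n) * (\<Prod>i\<in>I - {j}. a i)))" if j: "j \<in> I" for j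
  proof -
    define J where "J = I - {j}"
    have J: "finite J" "j \<notin> J" "I = insert j J" "card J = n"
      using I j by (auto simp: J_def)
    have a_J: "a i > 0" if "i \<in> J" for i
      using a that J by auto
    let ?A = "K ^ n * (a j powr (\<alpha> - real n) * (\<Prod>i\<in>J. a i))"
    have A: "0 \<le> ?A"
      using cauchy_const_nonneg[of "\<alpha> / real n"] a_J
      by (intro mult_nonneg_nonneg prod_nonneg zero_le_power ballI) (auto simp: K_def less_imp_le)
    have "(\<integral>\<^sup>+f. F j f \<partial>PiM I (\<lambda>_. lborel)) =
        (\<integral>\<^sup>+y. \<integral>\<^sup>+x. F j (x(j := y)) \<partial>PiM J (\<lambda>_. lborel) \<partial>lborel)"
      using J F_meas[OF j] by (simp add: product_nn_integral_insert_rev)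
    also have "\<dots> \<le> (\<integral>\<^sup>+y. ennreal ?A * indicator {-1..1::real} y \<partial>lborel)"
    proof (intro nn_integral_mono)
      fix y :: real
      have "(\<integral>\<^sup>+x. F j (x(j := y)) \<partial>PiM J (\<lambda>_. lborel)) =
          (\<integral>\<^sup>+x. ennreal (\<bar>y\<bar> powr \<alpha>) * indicator {-1..1} y *
            (\<Prod>i\<in>J. ennreal (((\<bar>y\<bar> / a j)\<^sup>2 + (x i / a i)\<^sup>2) powr - (\<alpha> / real n / 2))) \<partial>PiM J (\<lambda>_. lborel))"
        unfolding F_def J_def[symmetric] fun_upd_same using J
        by (intro nn_integral_cong arg_cong2[where f = "(*)"] prod.cong) auto
      also have "\<dots> = ennreal (\<bar>y\<bar> powr \<alpha>) * indicator {-1..1} y *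
            (\<Prod>i\<in>J. \<integral>\<^sup>+t. ennreal (((\<bar>y\<bar> / a j)\<^sup>2 + (t / a i)\<^sup>2) powr - (\<alpha> / real n / 2)) \<partial>lborel)"
        by (subst nn_integral_cmult)
          (use J product_nn_integral_prod[OF J(1), of "\<lambda>i t. ennreal (((\<bar>y\<bar> / a j)\<^sup>2 + (t / a i)\<^sup>2) powr - (\<alpha> / real n / 2))"]
            in auto)
      also have "\<dots> \<le> ennreal ?A * indicator {-1..1} y"
      \<comment> \<open>The kernel formula needs \<open>s > 0\<close>. At \<open>y = 0\<close> the
        prefactor is \<open>0 powr \<alpha> = 0\<close>, so the product vanishes.\<close>
      proof (cases "y = 0")
        case False
        define s where "s = \<bar>y\<bar> / a j"
        have s: "s > 0"
          using False a[OF j] by (simp add: s_def)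
        have "(\<Prod>i\<in>J. \<integral>\<^sup>+t. ennreal (((\<bar>y\<bar> / a j)\<^sup>2 + (t / a i)\<^sup>2) powr - (\<alpha> / real n / 2)) \<partial>lborel) =
            (\<Prod>i\<in>J. ennreal (K * a i * s powr (1 - \<alpha> / real n)))"
          using s a_J \<alpha> I unfolding s_def[symmetric] K_def
          by (intro prod.cong nn_integral_cauchy_kernel refl) auto
        also have "\<dots> = ennreal (K ^ n * (\<Prod>i\<in>J. a i) * s powr (real n - \<alpha>))"
        proof -
          have "(\<Prod>i\<in>J. s powr (1 - \<alpha> / real n)) = s powr (real n - \<alpha>)"
            using powr_eq_prod_powr[OF J(1,4) _ s, of "real n - \<alpha>"] I by (simp add: diff_divide_distrib)
          then have "(\<Prod>i\<in>J. K * a i * s powr (1 - \<alpha> / real n)) = K ^ n * (\<Prod>i\<in>J. a i) * s powr (real n - \<alpha>)"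
            using J by (simp add: prod.distrib)
          then show ?thesis
            using a_J cauchy_const_nonneg[of "\<alpha> / real n"]
            by (subst prod_ennreal) (auto simp: K_def less_imp_le)
        qed
        finally have prod_eq: "(\<Prod>i\<in>J. \<integral>\<^sup>+t. ennreal (((\<bar>y\<bar> / a j)\<^sup>2 + (t / a i)\<^sup>2) powr - (\<alpha> / real n / 2)) \<partial>lborel) =
            ennreal (K ^ n * (\<Prod>i\<in>J. a i) * s powr (real n - \<alpha>))" .
        have "ennreal (\<bar>y\<bar> powr \<alpha>) * indicator {-1..1} y *
            (\<Prod>i\<in>J. \<integral>\<^sup>+t. ennreal (((\<bar>y\<bar> / a j)\<^sup>2 + (t / a i)\<^sup>2) powr - (\<alpha> / real n / 2)) \<partial>lborel) =
            ennreal (\<bar>y\<bar> powr \<alpha> * (K ^ n * (\<Prod>i\<in>J. a i) * s powr (real n - \<alpha>))) * indicator {-1..1} y"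
          unfolding prod_eq ennreal_mult'[OF powr_ge_zero] by (simp only: mult_ac)
        \<comment> \<open>The powers of |y| add up to \<alpha> + (n - \<alpha>) = n, while the
          half-axis \<open>a j\<close> contributes the power \<alpha> - n.\<close>
        also have "\<bar>y\<bar> powr \<alpha> * (K ^ n * (\<Prod>i\<in>J. a i) * s powr (real n - \<alpha>)) = ?A * \<bar>y\<bar> ^ n"
        proof -
          have "s powr (real n - \<alpha>) = \<bar>y\<bar> ^ n / \<bar>y\<bar> powr \<alpha> * a j powr (\<alpha> - real n)"
            using False a[OF j]
            by (simp add: s_def powr_divide powr_diff powr_realpow divide_simps)
          then show ?thesis
            using False by simp
        qed
        also have "ennreal (?A * \<bar>y\<bar> ^ n) * indicator {-1..1} y \<le> ennreal ?A * indicator {-1..1} y"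
          using A by (auto simp: indicator_def intro!: ennreal_leI mult_left_le power_le_one)
        finally show ?thesis .
      qed simp
      finally show "(\<integral>\<^sup>+x. F j (x(j := y)) \<partial>PiM J (\<lambda>_. lborel)) \<le> ennreal ?A * indicator {-1..1} y" .
    qed
    also have "\<dots> = ennreal ?A * 2"
      by (subst nn_integral_cmult) auto
    also have "\<dots> = ennreal (2 * K ^ n * (a j powr (\<alpha> - real n) * (\<Prod>i\<in>I - {j}. a i)))"
      using A unfolding J_def[symmetric] by (simp add: ennreal_mult'[symmetric] mult_ac flip: ennreal_numeral)
    finally show ?thesis .
  qed
  have "(\<integral>\<^sup>+f. ball_integrand I a \<alpha> f \<partial>PiM I (\<lambda>_. lborel)) \<le>
      (\<integral>\<^sup>+f. (\<Sum>j\<in>I. ennreal (real (n + 1) powr (\<alpha> / 2)) * F j f) \<partial>PiM I (\<lambda>_. lborel))"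
    unfolding F_def using assms by (intro nn_integral_mono ball_integrand_le_sum) auto
  also have "\<dots> = (\<Sum>j\<in>I. ennreal (real (n + 1) powr (\<alpha> / 2)) * (\<integral>\<^sup>+f. F j f \<partial>PiM I (\<lambda>_. lborel)))"
    by (subst nn_integral_sum) (auto simp: nn_integral_cmult)
  also have "\<dots> \<le> (\<Sum>j\<in>I. ennreal (real (n + 1) powr (\<alpha> / 2)) *
      ennreal (2 * K ^ n * (a j powr (\<alpha> - real n) * (\<Prod>i\<in>I - {j}. a i))))"
    by (intro sum_mono mult_left_mono F_int) auto
  also have "\<dots> = (\<Sum>j\<in>I. ennreal (real (n + 1) powr (\<alpha> / 2) * (2 * K ^ n) *
      (a j powr (\<alpha> - real n) * (\<Prod>i\<in>I - {j}. a i))))"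
    by (simp add: ennreal_mult' mult.assoc)
  also have "\<dots> = ennreal (\<Sum>j\<in>I. real (n + 1) powr (\<alpha> / 2) * (2 * K ^ n) *
      (a j powr (\<alpha> - real n) * (\<Prod>i\<in>I - {j}. a i)))"
    using cauchy_const_nonneg[of "\<alpha> / real n"] a
    by (intro sum_ennreal mult_nonneg_nonneg prod_nonneg zero_le_power ballI) (auto simp: K_def less_imp_le)
  finally show ?thesis
    by (simp add: K_def)
qed

text \<open>\<open>powr\<close> returns 0 at base 0, which is too small for an upper bound of a
  singular function. The value \<infinity> at \<open>t = 0\<close> repairs this and affects only a
  null set.\<close>

lemma nn_integral_abs_powr_scaled_le:
  fixes b \<kappa> :: real
  assumes "b > 0" "\<kappa> < 1"
  shows "(\<integral>\<^sup>+t. (if t = 0 then \<infinity> else ennreal ((\<bar>t\<bar> / b) powr - \<kappa>)) * indicator {-1..1} t \<partial>lborel) \<le>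
    ennreal (2 / (1 - \<kappa>) * b powr \<kappa>)"
proof -
  have "(\<integral>\<^sup>+t. (if t = 0 then \<infinity> else ennreal ((\<bar>t\<bar> / b) powr - \<kappa>)) * indicator {-1..1} t \<partial>lborel) =
      (\<integral>\<^sup>+t. ennreal (b powr \<kappa>) * (ennreal (\<bar>t\<bar> powr - \<kappa>) * indicator {-1..1} t) \<partial>lborel)"
  proof (intro nn_integral_cong_AE)
    show "AE t in lborel. (if t = 0 then \<infinity> else ennreal ((\<bar>t\<bar> / b) powr - \<kappa>)) * indicator {-1..1} t =
        ennreal (b powr \<kappa>) * (ennreal (\<bar>t\<bar> powr - \<kappa>) * indicator {-1..1} t)"
      using AE_lborel_singleton[of "0::real"]
    proof eventually_elim
      case (elim t)
      have "(\<bar>t\<bar> / b) powr - \<kappa> = b powr \<kappa> * \<bar>t\<bar> powr - \<kappa>"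
        using assms by (simp add: powr_divide powr_minus divide_simps)
      then show ?case
        using elim by (simp add: ennreal_mult' mult.assoc)
    qed
  qed
  also have "\<dots> = ennreal (b powr \<kappa>) * (\<integral>\<^sup>+t. ennreal (\<bar>t\<bar> powr - \<kappa>) * indicator {-1..1} t \<partial>lborel)"
    by (rule nn_integral_cmult) auto
  also have "\<dots> \<le> ennreal (b powr \<kappa>) * ennreal (2 / (1 - \<kappa>))"
    by (intro mult_left_mono nn_integral_abs_powr_le assms) auto
  also have "\<dots> = ennreal (2 / (1 - \<kappa>) * b powr \<kappa>)"
    by (simp add: ennreal_mult'[symmetric] mult.commute)
  finally show ?thesis .
qed

text \<open>On the ball the numerator is at most 1, and integrating coordinate \<open>k\<close> over
  the whole line leaves the power 1 - \<beta> of the length \<open>s\<close> of the remaining scaled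
  coordinates; this needs \<beta> > 1. Since \<open>s\<close> dominates each of these, its power
  splits into one-dimensional singularities of order (\<beta> - 1)/n, integrable because \<beta> < n
  + 1.\<close>

proposition nn_integral_ball_integrand_le:
  fixes \<beta> :: real
  assumes I: "finite I" "card I = n + 1" "n \<ge> 1" and k: "k \<in> I"
    and \<beta>: "1 < \<beta>" "\<beta> < real (n + 1)"
    and a: "\<And>i. i \<in> I \<Longrightarrow> a i > 0"
  shows "(\<integral>\<^sup>+f. ball_integrand I a \<beta> f \<partial>PiM I (\<lambda>_. lborel)) \<le>
    ennreal ((cauchy_const \<beta> + 1) * (2 / (1 - (\<beta> - 1) / real n)) ^ n *
      (a k * (\<Prod>i\<in>I - {k}. a i powr ((\<beta> - 1) / real n))))"
proof -
  interpret product_sigma_finite "\<lambda>_. lborel :: real measure" ..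
  define \<kappa> where "\<kappa> = (\<beta> - 1) / real n"
  have \<kappa>: "0 < \<kappa>" "\<kappa> < 1"
    using I \<beta> by (auto simp: \<kappa>_def field_simps)
  define J where "J = I - {k}"
  have J: "finite J" "k \<notin> J" "I = insert k J" "card J = n"
    using I k by (auto simp: J_def)
  have a_J: "a i > 0" if "i \<in> J" for i
    using a that J by auto
  \<comment> \<open>The constant is enlarged by one to be visibly nonzero: it is multiplied by \<open>\<infinity>\<close> below.\<close>
  define K where "K = (cauchy_const \<beta> + 1) * a k"
  have K: "K > 0"
    using a[OF k] cauchy_const_nonneg[of \<beta>] by (simp add: K_def)
  define g where "g i t = (if t = 0 then \<infinity> else ennreal ((\<bar>t\<bar> / a i) powr - \<kappa>)) * indicator {-1..1} t" for i and t :: real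
  have g_meas [measurable]: "g i \<in> borel_measurable borel" for i
    unfolding g_def by measurable
  have slice: "(\<integral>\<^sup>+y. ball_integrand I a \<beta> (x(k := y)) \<partial>lborel) \<le> ennreal K * (\<Prod>i\<in>J. g i (x i))" for x
  \<comment> \<open>Outside the cube the whole line in direction \<open>k\<close> misses the unit
    ball, so the left side is 0.\<close>
  proof (cases "\<forall>i\<in>J. x i \<in> {-1..1}")
    case False
    then obtain i where i: "i \<in> J" "x i \<notin> {-1..1}"
      by blast
    have "1 < (x i)\<^sup>2"
      using i abs_square_le_1[of "x i"] by (auto simp: abs_le_iff not_le)
    also have "(x i)\<^sup>2 \<le> ellipsoid_form I (\<lambda>_. 1) (x(k := y))" for y
      using component_le_ellipsoid_form[OF I(1), of i "x(k := y)" "\<lambda>_. 1"] i J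
      by (cases "i = k") auto
    finally have "ball_integrand I a \<beta> (x(k := y)) = 0" for y
      by (simp add: ball_integrand_def not_le)
    then show ?thesis
      by simp
  next
    case x: True
    show ?thesis
    \<comment> \<open>With a vanishing coordinate the right side is \<infinity>, since
      \<open>K\<close> and all other factors are nonzero. In the other case \<open>s > 0\<close>, as
      the kernel formula requires.\<close>
    proof (cases "\<exists>i\<in>J. x i = 0")
      case True
      then obtain i where i: "i \<in> J" "x i = 0"
        by blast
      have "g j (x j) \<noteq> 0" if "j \<in> J" for j
        using that x a_J[OF that] by (auto simp: g_def)
      then have "(\<Prod>j\<in>J - {i}. g j (x j)) \<noteq> 0"
        using J by auto
      moreover have "g i (x i) = \<infinity>"
        using i by (simp add: g_def)
      ultimately have "(\<Prod>j\<in>J. g j (x j)) = \<infinity>"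
        using J i by (simp add: prod.remove[of J i] ennreal_top_mult)
      then show ?thesis
        using K by (simp add: ennreal_mult_top)
    next
      case nz: False
      define s where "s = sqrt (\<Sum>i\<in>J. (x i / a i)\<^sup>2)"
      have comp_le: "\<bar>x i\<bar> / a i \<le> s" if "i \<in> J" for i
      proof -
        have "(x i / a i)\<^sup>2 \<le> (\<Sum>i\<in>J. (x i / a i)\<^sup>2)"
          using J that by (intro member_le_sum) auto
        then have "sqrt ((x i / a i)\<^sup>2) \<le> s"
          unfolding s_def by (rule real_sqrt_le_mono)
        then show ?thesis
          using a_J[OF that] by (simp add: abs_div)
      qed
      obtain i0 where i0: "i0 \<in> J"
        using J I by fastforce
      then have "0 < \<bar>x i0\<bar> / a i0"
        using a_J nz by auto
      then have s: "s > 0"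
        using comp_le[OF i0] by linarith
      have form: "ellipsoid_form I a (x(k := y)) = s\<^sup>2 + (y / a k)\<^sup>2" for y
      proof -
        have "ellipsoid_form I a (x(k := y)) = (y / a k)\<^sup>2 + (\<Sum>i\<in>J. ((x(k := y)) i / a i)\<^sup>2)"
          using J by (simp add: ellipsoid_form_def)
        also have "(\<Sum>i\<in>J. ((x(k := y)) i / a i)\<^sup>2) = (\<Sum>i\<in>J. (x i / a i)\<^sup>2)"
          using J by (intro sum.cong) auto
        finally show ?thesis
          by (simp add: s_def sum_nonneg fun_upd_def)
      qed
      have "ball_integrand I a \<beta> (x(k := y)) \<le> ennreal ((s\<^sup>2 + (y / a k)\<^sup>2) powr - (\<beta> / 2))" for y
      proof (cases "0 < ellipsoid_form I (\<lambda>_. 1) (x(k := y)) \<and> ellipsoid_form I (\<lambda>_. 1) (x(k := y)) \<le> 1")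
        case True
        let ?q = "ellipsoid_form I (\<lambda>_. 1) (x(k := y))" and ?Q = "s\<^sup>2 + (y / a k)\<^sup>2"
        have "?Q > 0"
          using s by (intro add_pos_nonneg) auto
        have "(?q / ?Q) powr (\<beta> / 2) \<le> (1 / ?Q) powr (\<beta> / 2)"
          using True \<beta> \<open>?Q > 0\<close> by (intro powr_mono2 divide_right_mono) auto
        also have "\<dots> = ?Q powr - (\<beta> / 2)"
          using \<open>?Q > 0\<close> by (simp add: powr_divide powr_minus divide_simps)
        finally show ?thesis
          using True by (simp add: ball_integrand_def form ennreal_leI)
      qed (simp add: ball_integrand_def)
      then have "(\<integral>\<^sup>+y. ball_integrand I a \<beta> (x(k := y)) \<partial>lborel) \<le>
          (\<integral>\<^sup>+y. ennreal ((s\<^sup>2 + (y / a k)\<^sup>2) powr - (\<beta> / 2)) \<partial>lborel)"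
        by (intro nn_integral_mono)
      also have "\<dots> = ennreal (cauchy_const \<beta> * a k * s powr (1 - \<beta>))"
        using \<beta> s a[OF k] by (intro nn_integral_cauchy_kernel) auto
      also have "\<dots> \<le> ennreal (K * (\<Prod>i\<in>J. (\<bar>x i\<bar> / a i) powr - \<kappa>))"
      proof (intro ennreal_leI mult_mono)
        have "s powr (1 - \<beta>) = (\<Prod>i\<in>J. s powr - \<kappa>)"
          using powr_eq_prod_powr[OF J(1,4) _ s, of "1 - \<beta>"] I by (simp add: \<kappa>_def minus_divide_left)
        also have "\<dots> \<le> (\<Prod>i\<in>J. (\<bar>x i\<bar> / a i) powr - \<kappa>)"
          using comp_le a_J nz \<kappa> by (intro prod_mono conjI powr_mono2') auto
        finally show "s powr (1 - \<beta>) \<le> (\<Prod>i\<in>J. (\<bar>x i\<bar> / a i) powr - \<kappa>)" .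
        show "cauchy_const \<beta> * a k \<le> K"
          using a[OF k] by (simp add: K_def)
      qed (use K in auto)
      also have "\<dots> = ennreal K * (\<Prod>i\<in>J. ennreal ((\<bar>x i\<bar> / a i) powr - \<kappa>))"
        using K by (simp add: ennreal_mult' prod_ennreal)
      also have "(\<Prod>i\<in>J. ennreal ((\<bar>x i\<bar> / a i) powr - \<kappa>)) = (\<Prod>i\<in>J. g i (x i))"
        using x nz by (intro prod.cong) (auto simp: g_def)
      finally show ?thesis .
    qed
  qed
  \<comment> \<open>Here the distinguished coordinate is the inner variable; in the previous bound
    the pivot was the outer one.\<close>
  have "(\<integral>\<^sup>+f. ball_integrand I a \<beta> f \<partial>PiM I (\<lambda>_. lborel)) =
      (\<integral>\<^sup>+x. \<integral>\<^sup>+y. ball_integrand I a \<beta> (x(k := y)) \<partial>lborel \<partial>PiM J (\<lambda>_. lborel))"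
    using product_nn_integral_insert[OF J(1,2), of "ball_integrand I a \<beta>"] J(3) by simp
  also have "\<dots> \<le> (\<integral>\<^sup>+x. ennreal K * (\<Prod>i\<in>J. g i (x i)) \<partial>PiM J (\<lambda>_. lborel))"
    by (intro nn_integral_mono slice)
  also have "\<dots> = ennreal K * (\<Prod>i\<in>J. \<integral>\<^sup>+t. g i t \<partial>lborel)"
    using J by (subst nn_integral_cmult) (auto simp: product_nn_integral_prod)
  also have "\<dots> \<le> ennreal K * (\<Prod>i\<in>J. ennreal (2 / (1 - \<kappa>) * a i powr \<kappa>))"
    unfolding g_def using a_J \<kappa>
    by (intro mult_left_mono prod_mono_ennreal nn_integral_abs_powr_scaled_le) auto
  also have "\<dots> = ennreal (K * (\<Prod>i\<in>J. 2 / (1 - \<kappa>) * a i powr \<kappa>))"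
    using K \<kappa> by (simp add: ennreal_mult' prod_ennreal)
  also have "K * (\<Prod>i\<in>J. 2 / (1 - \<kappa>) * a i powr \<kappa>) =
      (cauchy_const \<beta> + 1) * (2 / (1 - \<kappa>)) ^ n * (a k * (\<Prod>i\<in>J. a i powr \<kappa>))"
    using J by (simp add: prod.distrib K_def del: times_divide_eq_left)
  finally show ?thesis
    by (simp add: \<kappa>_def J_def)
qed

section \<open>Lowering exponents and balancing an ellipsoid against its polar\<close>

lemma ellipsoid_form_1_le_1_imp_component:
  assumes "finite I" "ellipsoid_form I (\<lambda>_. 1) f \<le> 1" "i \<in> I"
  shows "f i \<in> {-1..1}"
  using component_le_ellipsoid_form[OF assms(1,3), of f "\<lambda>_. 1"] assms(2) abs_square_le_1[of "f i"]
  by (auto simp: abs_le_iff)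

text \<open>A substitute for Hoelder's inequality that keeps the scale \<open>R\<close>: for a
  radius u, either u is at most \<open>R\<close>, or lowering the exponent from \<open>p1\<close> to
  \<open>p\<close> costs at most the factor \<open>R powr (p - p1)\<close>.\<close>

lemma ball_integrand_lower_exponent:
  fixes p p1 R C :: real
  assumes I: "finite I" and p: "0 < p" "p \<le> p1" and R: "R > 0" and C: "C \<ge> 0"
    and le: "(\<integral>\<^sup>+f. ball_integrand I a p1 f \<partial>PiM I (\<lambda>_. lborel)) \<le> ennreal (C * R powr p1)"
  shows "(\<integral>\<^sup>+f. ball_integrand I a p f \<partial>PiM I (\<lambda>_. lborel)) \<le> ennreal ((2 ^ card I + C) * R powr p)"
proof -
  interpret product_sigma_finite "\<lambda>_. lborel :: real measure" ..
  \<comment> \<open>The unit ball is enlarged to the cube with sides [-1, 1], whose volume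
    \<open>2 ^ card I\<close> is an immediate product integral.\<close>
  have "ball_integrand I a p f \<le>
      ennreal (R powr p) * (\<Prod>i\<in>I. indicator {-1..1} (f i)) + ennreal (R powr (p - p1)) * ball_integrand I a p1 f" for f
  proof (cases "0 < ellipsoid_form I (\<lambda>_. 1) f \<and> ellipsoid_form I (\<lambda>_. 1) f \<le> 1")
    case True
    define t where "t = ellipsoid_form I (\<lambda>_. 1) f / ellipsoid_form I a f"
    define u where "u = sqrt t"
    have "0 \<le> t"
      by (simp add: t_def ellipsoid_form_nonneg)
    then have u: "0 \<le> u" "t powr (q / 2) = u powr q" for q
      by (auto simp: u_def powr_half_sqrt[symmetric] powr_powr)
    have "u powr p \<le> R powr p + R powr (p - p1) * u powr p1"
    proof (cases "u \<le> R")
      case True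
      then have "u powr p \<le> R powr p"
        using p u by (intro powr_mono2) auto
      then show ?thesis
        by (simp add: add_increasing2)
    next
      case False
      then have "u powr (p - p1) \<le> R powr (p - p1)"
        using p R by (intro powr_mono2') auto
      then have "u powr (p - p1) * u powr p1 \<le> R powr (p - p1) * u powr p1"
        by (intro mult_right_mono) auto
      also have "u powr (p - p1) * u powr p1 = u powr p"
        by (simp flip: powr_add)
      finally show ?thesis
        by (simp add: add_increasing)
    qed
    moreover have "(\<Prod>i\<in>I. indicator {-1..1} (f i)) = (1 :: ennreal)"
      using True ellipsoid_form_1_le_1_imp_component[OF I] by (intro prod.neutral) auto
    ultimately show ?thesis
      using True
      by (simp add: ball_integrand_def t_def[symmetric] u ennreal_leI flip: ennreal_mult' ennreal_plus)
  qed (simp add: ball_integrand_def)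
  then have "(\<integral>\<^sup>+f. ball_integrand I a p f \<partial>PiM I (\<lambda>_. lborel)) \<le>
      (\<integral>\<^sup>+f. ennreal (R powr p) * (\<Prod>i\<in>I. indicator {-1..1} (f i)) +
        ennreal (R powr (p - p1)) * ball_integrand I a p1 f \<partial>PiM I (\<lambda>_. lborel))"
    by (intro nn_integral_mono)
  also have "\<dots> = ennreal (R powr p) * (\<integral>\<^sup>+f. (\<Prod>i\<in>I. indicator {-1..1::real} (f i)) \<partial>PiM I (\<lambda>_. lborel)) +
      ennreal (R powr (p - p1)) * (\<integral>\<^sup>+f. ball_integrand I a p1 f \<partial>PiM I (\<lambda>_. lborel))"
    by (simp add: nn_integral_add nn_integral_cmult)
  also have "(\<integral>\<^sup>+f. (\<Prod>i\<in>I. indicator {-1..1::real} (f i)) \<partial>PiM I (\<lambda>_. lborel)) = (\<Prod>i\<in>I. 2 :: ennreal)"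
    using I by (subst product_nn_integral_prod) auto
  also have "\<dots> = ennreal (2 ^ card I)"
    by (simp add: ennreal_power flip: ennreal_numeral)
  also have "ennreal (R powr (p - p1)) * (\<integral>\<^sup>+f. ball_integrand I a p1 f \<partial>PiM I (\<lambda>_. lborel)) \<le>
      ennreal (R powr (p - p1)) * ennreal (C * R powr p1)"
    by (intro mult_left_mono le) auto
  also have "ennreal (R powr (p - p1)) * ennreal (C * R powr p1) = ennreal (C * R powr p)"
  proof -
    have "R powr (p - p1) * (C * R powr p1) = C * (R powr (p - p1) * R powr p1)"
      by (simp only: mult_ac)
    also have "\<dots> = C * R powr p"
      by (simp flip: powr_add)
    finally show ?thesis
      by (simp only: ennreal_mult'[OF powr_ge_zero, symmetric])
  qed
  also have "ennreal (R powr p) * ennreal (2 ^ card I) + ennreal (C * R powr p) =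
      ennreal ((2 ^ card I + C) * R powr p)"
    using C by (simp add: algebra_simps flip: ennreal_mult' ennreal_plus)
  finally show ?thesis
    by (simp add: add_left_mono)
qed

text \<open>One scale \<open>R\<close> must govern both integrals, so that it cancels after taking
  roots. The largest summand \<open>X j\<close> of the first bound defines \<open>R\<close>, and the
  second bound is applied to \<open>1 / a\<close> with the same \<open>j\<close> as distinguished
  coordinate.\<close>

lemma ball_integral_product_bound_large:
  fixes \<alpha> \<beta> :: real and I :: "'i set"
  assumes I: "finite I" "card I = n + 1" "n \<ge> 1" and \<alpha>: "\<alpha> > real (n + 1)" and \<beta>: "\<beta> > 0"
    and cond: "real n / \<alpha> + 1 / \<beta> \<ge> 1"
  shows "\<exists>C\<ge>0. \<forall>a. (\<forall>i\<in>I. a i > 0) \<longrightarrow> (\<exists>R>0.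
    (\<integral>\<^sup>+f. ball_integrand I a \<alpha> f \<partial>PiM I (\<lambda>_. lborel)) \<le> ennreal (C * R powr \<alpha>) \<and>
    (\<integral>\<^sup>+f. ball_integrand I (\<lambda>i. 1 / a i) \<beta> f \<partial>PiM I (\<lambda>_. lborel)) \<le> ennreal (C * R powr - \<beta>))"
proof -
  \<comment> \<open>\<beta>1 is the exponent for which n/\<alpha> + 1/\<beta>1 = 1, so \<beta> is at
    most \<beta>1 by \<open>cond\<close>. Moreover \<beta>1 < n + 1 amounts to \<alpha> > n + 1, the
    range in which the second bound applies.\<close>
  define \<beta>1 where "\<beta>1 = \<alpha> / (\<alpha> - real n)"
  define \<kappa> where "\<kappa> = 1 / (\<alpha> - real n)"
  have pos: "\<alpha> - real n > 0" "\<alpha> > 0"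
    using \<alpha> by auto
  have \<kappa>: "(\<beta>1 - 1) / real n = \<kappa>" "(\<alpha> - real n) * \<kappa> = 1" "\<beta>1 / \<alpha> = \<kappa>"
    using pos I by (auto simp: \<beta>1_def \<kappa>_def field_simps)
  have "1 < \<beta>1"
    using pos I by (simp add: \<beta>1_def)
  have "real n * real (n + 1) < real n * \<alpha>"
    using \<alpha> I by (intro mult_strict_left_mono) auto
  then have "\<beta>1 < real (n + 1)"
    using pos by (simp add: \<beta>1_def pos_divide_less_eq algebra_simps)
  have "\<beta> \<le> \<beta>1"
    using cond pos \<beta> by (simp add: \<beta>1_def field_simps)
  define C1 where "C1 = real (n + 1) * (real (n + 1) powr (\<alpha> / 2) * (2 * cauchy_const (\<alpha> / real n) ^ n))"
  define C2 where "C2 = (cauchy_const \<beta>1 + 1) * (2 / (1 - \<kappa>)) ^ n"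
  define C where "C = max C1 (2 ^ card I + C2)"
  have C1: "C1 \<ge> 0"
    unfolding C1_def by (intro mult_nonneg_nonneg zero_le_power cauchy_const_nonneg) auto
  have "\<kappa> < 1"
    using \<alpha> by (simp add: \<kappa>_def)
  then have C2: "C2 \<ge> 0"
    unfolding C2_def using cauchy_const_nonneg[of \<beta>1] by simp
  have "\<exists>R>0.
    (\<integral>\<^sup>+f. ball_integrand I a \<alpha> f \<partial>PiM I (\<lambda>_. lborel)) \<le> ennreal (C * R powr \<alpha>) \<and>
    (\<integral>\<^sup>+f. ball_integrand I (\<lambda>i. 1 / a i) \<beta> f \<partial>PiM I (\<lambda>_. lborel)) \<le> ennreal (C * R powr - \<beta>)"
    if a: "\<forall>i\<in>I. a i > 0" for a
  proof -
    define X where "X j = a j powr (\<alpha> - real n) * (\<Prod>i\<in>I - {j}. a i)" for j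
    have "I \<noteq> {}"
      using I by auto
    then obtain j where j: "j \<in> I" and j_max: "\<And>i. i \<in> I \<Longrightarrow> X i \<le> X j"
      using I obtains_MAX[of I X] by (metis Max_ge finite_imageI imageI)
    have Xj: "X j > 0"
      unfolding X_def using a j by (intro mult_pos_pos prod_pos) auto
    define R where "R = X j powr (1 / \<alpha>)"
    have R: "R > 0" "R powr \<alpha> = X j" "R powr - \<beta>1 = X j powr - \<kappa>"
      using Xj pos \<kappa>(3) by (auto simp: R_def powr_powr)
    have "(\<integral>\<^sup>+f. ball_integrand I a \<alpha> f \<partial>PiM I (\<lambda>_. lborel)) \<le>
        ennreal (\<Sum>j\<in>I. real (n + 1) powr (\<alpha> / 2) * (2 * cauchy_const (\<alpha> / real n) ^ n) * X j)"
      unfolding X_def using I \<alpha> a by (intro nn_integral_ball_integrand_le_sum) auto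
    also have "(\<Sum>j\<in>I. real (n + 1) powr (\<alpha> / 2) * (2 * cauchy_const (\<alpha> / real n) ^ n) * X j) \<le>
        (\<Sum>i\<in>I. real (n + 1) powr (\<alpha> / 2) * (2 * cauchy_const (\<alpha> / real n) ^ n) * X j)"
      using j_max by (intro sum_mono mult_left_mono mult_nonneg_nonneg zero_le_power cauchy_const_nonneg) auto
    also have "\<dots> = C1 * R powr \<alpha>"
      using I by (simp add: C1_def R(2))
    also have "\<dots> \<le> C * R powr \<alpha>"
      by (intro mult_right_mono) (auto simp: C_def)
    finally have 1: "(\<integral>\<^sup>+f. ball_integrand I a \<alpha> f \<partial>PiM I (\<lambda>_. lborel)) \<le> ennreal (C * R powr \<alpha>)"
      by (simp add: ennreal_leI)
    have "(\<integral>\<^sup>+f. ball_integrand I (\<lambda>i. 1 / a i) \<beta>1 f \<partial>PiM I (\<lambda>_. lborel)) \<le>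
        ennreal (C2 * (1 / a j * (\<Prod>i\<in>I - {j}. (1 / a i) powr \<kappa>)))"
      unfolding C2_def \<kappa>(1)[symmetric]
      using I j a \<open>1 < \<beta>1\<close> \<open>\<beta>1 < real (n + 1)\<close> by (intro nn_integral_ball_integrand_le) auto
    \<comment> \<open>Exact reciprocity: the left side is \<open>X j powr - \<kappa>\<close>,
      because (\<alpha> - n) \<kappa> = 1 turns the power of \<open>a j\<close> into
      \<open>1 / a j\<close>.\<close>
    also have "1 / a j * (\<Prod>i\<in>I - {j}. (1 / a i) powr \<kappa>) = R powr - \<beta>1"
    proof -
      have "X j powr - \<kappa> = (a j powr (\<alpha> - real n)) powr - \<kappa> * (\<Prod>i\<in>I - {j}. a i) powr - \<kappa>"
        by (simp add: X_def powr_mult)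
      also have "(a j powr (\<alpha> - real n)) powr - \<kappa> = 1 / a j"
        using a[rule_format, OF j] \<kappa>(2) by (simp add: powr_powr powr_minus divide_simps)
      also have "(\<Prod>i\<in>I - {j}. a i) powr - \<kappa> = (\<Prod>i\<in>I - {j}. a i powr - \<kappa>)"
        by (rule prod_powr_distrib)
      also have "\<dots> = (\<Prod>i\<in>I - {j}. (1 / a i) powr \<kappa>)"
        using a by (intro prod.cong) (auto simp: powr_minus powr_divide divide_simps)
      finally show ?thesis
        by (simp add: R(3))
    qed
    finally have "(\<integral>\<^sup>+f. ball_integrand I (\<lambda>i. 1 / a i) \<beta> f \<partial>PiM I (\<lambda>_. lborel)) \<le>
        ennreal ((2 ^ card I + C2) * (1 / R) powr \<beta>)"
      using ball_integrand_lower_exponent[OF I(1) \<beta> \<open>\<beta> \<le> \<beta>1\<close> _ C2, of "1 / R" "\<lambda>i. 1 / a i"] R(1)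
      by (simp add: powr_minus powr_divide divide_simps)
    also have "\<dots> \<le> ennreal (C * (1 / R) powr \<beta>)"
      by (intro ennreal_leI mult_right_mono) (auto simp: C_def)
    also have "(1 / R) powr \<beta> = R powr - \<beta>"
      using R(1) by (simp add: powr_minus powr_divide divide_simps)
    finally show ?thesis
      using 1 R(1) by blast
  qed
  moreover have "C \<ge> 0"
    using C1 by (simp add: C_def)
  ultimately show ?thesis
    by blast
qed

text \<open>At exponent n + 1 every summand of the first bound is the product of all half-axes,
  which is the volume up to a constant. The geometric mean of the half-axes then serves as the scale
  for lowering the exponent.\<close>

lemma ball_integral_volume_bound:
  fixes p :: real and I :: "'i set"
  assumes I: "finite I" "card I = n + 1" "n \<ge> 1" and p: "0 < p" "p \<le> real (n + 1)"
  shows "\<exists>C\<ge>0. \<forall>a. (\<forall>i\<in>I. a i > 0) \<longrightarrow>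
    (\<integral>\<^sup>+f. ball_integrand I a p f \<partial>PiM I (\<lambda>_. lborel)) \<le>
      ennreal (C * ((\<Prod>i\<in>I. a i) powr (1 / real (n + 1))) powr p)"
proof -
  define C where "C = real (n + 1) * (real (n + 1) powr (real (n + 1) / 2) * (2 * cauchy_const (real (n + 1) / real n) ^ n))"
  have C: "C \<ge> 0"
    unfolding C_def by (intro mult_nonneg_nonneg zero_le_power cauchy_const_nonneg) auto
  have "(\<integral>\<^sup>+f. ball_integrand I a p f \<partial>PiM I (\<lambda>_. lborel)) \<le>
      ennreal ((2 ^ card I + C) * ((\<Prod>i\<in>I. a i) powr (1 / real (n + 1))) powr p)"
    if a: "\<forall>i\<in>I. a i > 0" for a
  proof -
    have prod: "(\<Prod>i\<in>I. a i) > 0"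
      using a by (intro prod_pos) auto
    have "(\<integral>\<^sup>+f. ball_integrand I a (real (n + 1)) f \<partial>PiM I (\<lambda>_. lborel)) \<le>
        ennreal (\<Sum>j\<in>I. real (n + 1) powr (real (n + 1) / 2) * (2 * cauchy_const (real (n + 1) / real n) ^ n) *
          (a j powr (real (n + 1) - real n) * (\<Prod>i\<in>I - {j}. a i)))"
      using I a by (intro nn_integral_ball_integrand_le_sum) auto
    also have "(\<Sum>j\<in>I. real (n + 1) powr (real (n + 1) / 2) * (2 * cauchy_const (real (n + 1) / real n) ^ n) *
          (a j powr (real (n + 1) - real n) * (\<Prod>i\<in>I - {j}. a i))) =
        (\<Sum>j\<in>I. real (n + 1) powr (real (n + 1) / 2) * (2 * cauchy_const (real (n + 1) / real n) ^ n) *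
          (\<Prod>i\<in>I. a i))"
      using I a by (intro sum.cong refl) (simp add: prod.remove abs_of_pos)
    also have "\<dots> = C * ((\<Prod>i\<in>I. a i) powr (1 / real (n + 1))) powr real (n + 1)"
      using I prod by (simp add: C_def powr_powr del: of_nat_add of_nat_Suc)
    finally show ?thesis
      using prod by (intro ball_integrand_lower_exponent[OF I(1) p _ C]) auto
  qed
  then show ?thesis
    using C by (intro exI[of _ "2 ^ card I + C"]) auto
qed

text \<open>The constant is chosen before \<open>a\<close>, and all dependence on \<open>a\<close>
  sits in \<open>R\<close>. The two integrals scale as opposite powers of \<open>R\<close>, so the
  product of their roots no longer sees the ellipsoid.\<close>

proposition ball_integral_product_bound:
  fixes \<alpha> \<beta> :: real and I :: "'i set"
  assumes I: "finite I" "card I = n + 1" "n \<ge> 1" and \<alpha>: "\<alpha> > 0" and \<beta>: "\<beta> > 0"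
    and cond: "real n / \<alpha> + 1 / \<beta> \<ge> 1" "1 / \<alpha> + real n / \<beta> \<ge> 1"
  shows "\<exists>C\<ge>0. \<forall>a. (\<forall>i\<in>I. a i > 0) \<longrightarrow> (\<exists>R>0.
    (\<integral>\<^sup>+f. ball_integrand I a \<alpha> f \<partial>PiM I (\<lambda>_. lborel)) \<le> ennreal (C * R powr \<alpha>) \<and>
    (\<integral>\<^sup>+f. ball_integrand I (\<lambda>i. 1 / a i) \<beta> f \<partial>PiM I (\<lambda>_. lborel)) \<le> ennreal (C * R powr - \<beta>))"
proof -
  consider "\<alpha> > real (n + 1)" | "\<beta> > real (n + 1)" | "\<alpha> \<le> real (n + 1)" "\<beta> \<le> real (n + 1)"
    by linarith
  then show ?thesis
  proof cases
    case 1
    then show ?thesis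
      using ball_integral_product_bound_large[OF I _ \<beta> cond(1)] by blast
  next
    case 2
    \<comment> \<open>The second condition is the first one with the exponents exchanged. Applying
      the previous case to \<open>1 / a\<close> therefore gives the claim with \<open>1 / R\<close>
      as scale.\<close>
    have "real n / \<beta> + 1 / \<alpha> \<ge> 1"
      using cond(2) by simp
    from ball_integral_product_bound_large[OF I 2 \<alpha> this]
    obtain C where C: "C \<ge> 0" "\<And>a. \<forall>i\<in>I. a i > 0 \<Longrightarrow> \<exists>R>0.
        (\<integral>\<^sup>+f. ball_integrand I a \<beta> f \<partial>PiM I (\<lambda>_. lborel)) \<le> ennreal (C * R powr \<beta>) \<and>
        (\<integral>\<^sup>+f. ball_integrand I (\<lambda>i. 1 / a i) \<alpha> f \<partial>PiM I (\<lambda>_. lborel)) \<le> ennreal (C * R powr - \<alpha>)"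
      by blast
    have "\<exists>R>0.
        (\<integral>\<^sup>+f. ball_integrand I a \<alpha> f \<partial>PiM I (\<lambda>_. lborel)) \<le> ennreal (C * R powr \<alpha>) \<and>
        (\<integral>\<^sup>+f. ball_integrand I (\<lambda>i. 1 / a i) \<beta> f \<partial>PiM I (\<lambda>_. lborel)) \<le> ennreal (C * R powr - \<beta>)"
      if "\<forall>i\<in>I. a i > 0" for a
    proof -
      have "\<forall>i\<in>I. 1 / a i > 0"
        using that by simp
      from C(2)[OF this] obtain R where R: "R > 0"
        "(\<integral>\<^sup>+f. ball_integrand I (\<lambda>i. 1 / a i) \<beta> f \<partial>PiM I (\<lambda>_. lborel)) \<le> ennreal (C * R powr \<beta>)"
        "(\<integral>\<^sup>+f. ball_integrand I a \<alpha> f \<partial>PiM I (\<lambda>_. lborel)) \<le> ennreal (C * R powr - \<alpha>)"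
        by auto
      have "(1 / R) powr \<alpha> = R powr - \<alpha>" "(1 / R) powr - \<beta> = R powr \<beta>"
        using R(1) by (auto simp: powr_minus powr_divide divide_simps)
      then show ?thesis
        using R by (intro exI[of _ "1 / R"]) auto
    qed
    then show ?thesis
      using C(1) by blast
  next
    case 3
    obtain C1 where C1: "C1 \<ge> 0" "\<And>a. \<forall>i\<in>I. a i > 0 \<Longrightarrow>
        (\<integral>\<^sup>+f. ball_integrand I a \<alpha> f \<partial>PiM I (\<lambda>_. lborel)) \<le>
          ennreal (C1 * ((\<Prod>i\<in>I. a i) powr (1 / real (n + 1))) powr \<alpha>)"
      using ball_integral_volume_bound[OF I \<alpha> 3(1)] by blast
    obtain C2 where C2: "C2 \<ge> 0" "\<And>a. \<forall>i\<in>I. a i > 0 \<Longrightarrow>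
        (\<integral>\<^sup>+f. ball_integrand I a \<beta> f \<partial>PiM I (\<lambda>_. lborel)) \<le>
          ennreal (C2 * ((\<Prod>i\<in>I. a i) powr (1 / real (n + 1))) powr \<beta>)"
      using ball_integral_volume_bound[OF I \<beta> 3(2)] by blast
    have "\<exists>R>0.
        (\<integral>\<^sup>+f. ball_integrand I a \<alpha> f \<partial>PiM I (\<lambda>_. lborel)) \<le> ennreal (max C1 C2 * R powr \<alpha>) \<and>
        (\<integral>\<^sup>+f. ball_integrand I (\<lambda>i. 1 / a i) \<beta> f \<partial>PiM I (\<lambda>_. lborel)) \<le> ennreal (max C1 C2 * R powr - \<beta>)"
      if a: "\<forall>i\<in>I. a i > 0" for a
    proof -
      define P where "P = (\<Prod>i\<in>I. a i)"
      have P: "P > 0"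
        unfolding P_def using a by (intro prod_pos) auto
      define R where "R = P powr (1 / real (n + 1))"
      have R: "R > 0"
        using P by (simp add: R_def)
      have a': "\<forall>i\<in>I. 1 / a i > 0"
        using a by simp
      \<comment> \<open>Inverting the half-axes inverts the volume, so one geometric mean
        \<open>R\<close> serves both integrals.\<close>
      have prod_inverse: "(\<Prod>i\<in>I. 1 / a i) = 1 / P"
        by (simp add: P_def prod_dividef)
      have "((\<Prod>i\<in>I. 1 / a i) powr (1 / real (n + 1))) powr \<beta> = R powr - \<beta>"
        unfolding prod_inverse using P R by (simp add: R_def powr_minus powr_divide divide_simps)
      then have "(\<integral>\<^sup>+f. ball_integrand I (\<lambda>i. 1 / a i) \<beta> f \<partial>PiM I (\<lambda>_. lborel)) \<le> ennreal (C2 * R powr - \<beta>)"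
        using C2(2)[OF a'] by simp
      also have "\<dots> \<le> ennreal (max C1 C2 * R powr - \<beta>)"
        by (intro ennreal_leI mult_right_mono) auto
      finally have 2: "(\<integral>\<^sup>+f. ball_integrand I (\<lambda>i. 1 / a i) \<beta> f \<partial>PiM I (\<lambda>_. lborel)) \<le> ennreal (max C1 C2 * R powr - \<beta>)" .
      have "(\<integral>\<^sup>+f. ball_integrand I a \<alpha> f \<partial>PiM I (\<lambda>_. lborel)) \<le> ennreal (C1 * R powr \<alpha>)"
        using C1(2)[OF a] by (simp add: R_def P_def)
      also have "\<dots> \<le> ennreal (max C1 C2 * R powr \<alpha>)"
        by (intro ennreal_leI mult_right_mono) auto
      finally show ?thesis
        using 2 R by blast
    qed
    then show ?thesis
      using C1(1) by (intro exI[of _ "max C1 C2"]) auto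
  qed
qed

section \<open>Orthonormal frames and the sphere measure\<close>

text \<open>Indexing by \<open>Basis\<close> makes the frame the image of the standard basis under
  the isometry \<open>frame_map e\<close>, and lets its coordinates live on the index set of the
  product form of \<open>lborel\<close>.\<close>

definition orthonormal_frame :: "('a::euclidean_space \<Rightarrow> 'a) \<Rightarrow> bool" where
  "orthonormal_frame e \<longleftrightarrow> (\<forall>b\<in>Basis. \<forall>c\<in>Basis. e b \<bullet> e c = (if b = c then 1 else 0))"

definition frame_map :: "('a::euclidean_space \<Rightarrow> 'a) \<Rightarrow> 'a \<Rightarrow> 'a" where
  "frame_map e y = (\<Sum>b\<in>Basis. (y \<bullet> b) *\<^sub>R e b)"

lemma frame_map_inner:
  assumes "orthonormal_frame e" "b \<in> Basis"
  shows "frame_map e y \<bullet> e b = y \<bullet> b"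
proof -
  have "frame_map e y \<bullet> e b = (\<Sum>c\<in>Basis. (y \<bullet> c) * (e c \<bullet> e b))"
    by (simp add: frame_map_def inner_sum_left)
  also have "\<dots> = (\<Sum>c\<in>Basis. if c = b then y \<bullet> c else 0)"
    using assms by (intro sum.cong) (auto simp: orthonormal_frame_def)
  finally show ?thesis
    using assms by simp
qed

lemma orthogonal_transformation_frame_map:
  assumes "orthonormal_frame e"
  shows "orthogonal_transformation (frame_map e)"
  unfolding orthogonal_transformation_def
proof (intro conjI allI)
  show "linear (frame_map e)"
    unfolding frame_map_def by (intro linearI)
      (auto simp: inner_add_left scaleR_add_left sum.distrib scaleR_sum_right)
  fix v w :: 'a
  have "frame_map e v \<bullet> frame_map e w = (\<Sum>b\<in>Basis. (w \<bullet> b) * (frame_map e v \<bullet> e b))"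
    by (simp add: frame_map_def[of e w] inner_sum_right)
  also have "\<dots> = (\<Sum>b\<in>Basis. (w \<bullet> b) * (v \<bullet> b))"
    using assms by (intro sum.cong) (auto simp: frame_map_inner)
  also have "\<dots> = v \<bullet> w"
    by (subst euclidean_inner[of v w]) (simp add: mult.commute)
  finally show "frame_map e v \<bullet> frame_map e w = v \<bullet> w" .
qed

text \<open>Parseval's identity for the frame.\<close>

lemma ellipsoid_form_frame_1:
  assumes "orthonormal_frame e"
  shows "ellipsoid_form Basis (\<lambda>_. 1) (\<lambda>b. y \<bullet> e b) = (norm y)\<^sup>2"
proof -
  obtain v where v: "y = frame_map e v"
    using orthogonal_transformation_surj[OF orthogonal_transformation_frame_map[OF assms]] by (metis surjD)
  have "ellipsoid_form Basis (\<lambda>_. 1) (\<lambda>b. y \<bullet> e b) = (\<Sum>b\<in>Basis. (v \<bullet> b)\<^sup>2)"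
    using assms by (simp add: ellipsoid_form_def v frame_map_inner)
  also have "\<dots> = (norm v)\<^sup>2"
    by (simp add: norm_eq_sqrt_inner euclidean_inner[of v v] power2_eq_square sum_nonneg)
  also have "norm v = norm y"
    using orthogonal_transformation_frame_map[OF assms] by (simp add: v orthogonal_transformation)
  finally show ?thesis .
qed

lemma ellipsoid_form_scale:
  "ellipsoid_form I a (\<lambda>i. c * f i) = c\<^sup>2 * ellipsoid_form I a f"
  by (simp add: ellipsoid_form_def sum_distrib_left power_mult_distrib power_divide)

lemma measurable_ellipsoid_form_frame [measurable]:
  "(\<lambda>y::'a::euclidean_space. ellipsoid_form I a (\<lambda>b. y \<bullet> e b)) \<in> borel_measurable borel"
  unfolding ellipsoid_form_def by measurable

text \<open>
  Because the sphere measure is defined through the cone over a set, an integral over the sphere is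
  an integral over the ball of the \<open>0\<close>-homogeneous extension; no polar coordinates are needed.
\<close>

lemma nn_integral_sphere_measure:
  fixes h :: "'a::euclidean_space \<Rightarrow> ennreal"
  assumes [measurable]: "h \<in> borel_measurable borel"
  shows "(\<integral>\<^sup>+x. h x \<partial>sphere_measure) =
    of_nat DIM('a) * (\<integral>\<^sup>+y. h (y /\<^sub>R norm y) * indicator (cball 0 1 - {0}) y \<partial>lborel)"
proof -
  let ?L = "scale_measure (of_nat DIM('a)) lborel :: 'a measure"
  let ?B = "cball 0 1 - {0} :: 'a set"
  have B [measurable]: "?B \<in> sets borel"
    by measurable
  have "(\<lambda>x::'a. x /\<^sub>R norm x) \<in> borel_measurable borel"
    by measurable
  then have "(\<lambda>x::'a. x /\<^sub>R norm x) \<in> borel_measurable (restrict_space ?L ?B)"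
    by (intro measurable_restrict_space1) (simp add: measurable_def)
  then have m: "(\<lambda>x::'a. x /\<^sub>R norm x) \<in> restrict_space ?L ?B \<rightarrow>\<^sub>M restrict_space borel (sphere 0 1)"
    by (intro measurable_restrict_space2) (auto simp: space_restrict_space)
  have "(\<integral>\<^sup>+x. h x \<partial>sphere_measure) = (\<integral>\<^sup>+y. h (y /\<^sub>R norm y) \<partial>restrict_space ?L ?B)"
    unfolding sphere_measure_def
    by (rule nn_integral_distr[OF m]) (auto intro: measurable_restrict_space1)
  also have "\<dots> = (\<integral>\<^sup>+y. h (y /\<^sub>R norm y) * indicator ?B y \<partial>?L)"
    using B by (intro nn_integral_restrict_space) auto
  also have "\<dots> = of_nat DIM('a) * (\<integral>\<^sup>+y. h (y /\<^sub>R norm y) * indicator ?B y \<partial>lborel)"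
    by (rule nn_integral_scale_measure) measurable
  finally show ?thesis .
qed

text \<open>The form is homogeneous of degree 2, so extending its power from the sphere gives
  exactly \<open>ball_integrand\<close> in the frame coordinates. An isometry then turns the frame
  into the standard basis, where \<open>lborel\<close> is a product measure.\<close>

proposition nn_integral_sphere_ellipsoid:
  fixes e :: "'a::euclidean_space \<Rightarrow> 'a"
  assumes e: "orthonormal_frame e"
  shows "(\<integral>\<^sup>+x. ennreal (ellipsoid_form Basis a (\<lambda>b. x \<bullet> e b) powr - (p / 2)) \<partial>sphere_measure) =
    of_nat DIM('a) * (\<integral>\<^sup>+f. ball_integrand Basis a p f \<partial>PiM Basis (\<lambda>_. lborel))"
proof -
  let ?Q = "\<lambda>y::'a. ellipsoid_form Basis a (\<lambda>b. y \<bullet> e b)"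
  let ?G = "\<lambda>y::'a. ball_integrand Basis a p (\<lambda>b. y \<bullet> e b)"
  have pointwise: "ennreal (?Q (y /\<^sub>R norm y) powr - (p / 2)) * indicator (cball 0 1 - {0}) y = ?G y" for y
  proof (cases "y = 0")
    case False
    have "?Q (y /\<^sub>R norm y) = ?Q y / (norm y)\<^sup>2"
      using ellipsoid_form_scale[of Basis a "inverse (norm y)" "\<lambda>b. y \<bullet> e b"]
      by (simp add: power_inverse divide_inverse mult.commute)
    then have "?Q (y /\<^sub>R norm y) powr - (p / 2) = (?Q y / (norm y)\<^sup>2) powr - (p / 2)"
      by (rule arg_cong)
    also have "\<dots> = ((norm y)\<^sup>2 / ?Q y) powr (p / 2)"
      using False ellipsoid_form_nonneg[of Basis a]
      by (simp add: powr_divide powr_minus divide_simps)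
    finally have "?Q (y /\<^sub>R norm y) powr - (p / 2) = ((norm y)\<^sup>2 / ?Q y) powr (p / 2)" .
    moreover have "(indicator (cball 0 1 - {0}) y :: ennreal) = indicator {f. 0 < ellipsoid_form Basis (\<lambda>_. 1) f \<and> ellipsoid_form Basis (\<lambda>_. 1) f \<le> 1} (\<lambda>b. y \<bullet> e b)"
      using False by (auto simp: indicator_def ellipsoid_form_frame_1[OF e] abs_square_le_1)
    ultimately show ?thesis
      by (simp add: ball_integrand_def ellipsoid_form_frame_1[OF e])
  qed (simp add: ball_integrand_def ellipsoid_form_def)
  have [measurable]: "cball 0 1 - {0 :: 'a} \<in> sets borel"
    by measurable
  \<comment> \<open>Measurability is read off the left side of \<open>pointwise\<close>: the
    function \<open>\<lambda>b. y \<bullet> e b\<close> is in general not extensional on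
    \<open>Basis\<close>, hence not a point of the product space.\<close>
  have G_meas [measurable]: "?G \<in> borel_measurable borel"
    unfolding pointwise[symmetric] ellipsoid_form_def
    by (intro borel_measurable_times_ennreal borel_measurable_indicator) measurable
  have T: "distr lborel borel (frame_map e) = lborel"
    by (intro distr_lborel_orthogonal orthogonal_transformation_frame_map e)
  have T_meas [measurable]: "frame_map e \<in> borel_measurable borel"
    unfolding frame_map_def by measurable
  have "(\<integral>\<^sup>+y. ?G y \<partial>lborel) = (\<integral>\<^sup>+y. ?G (frame_map e y) \<partial>lborel)"
    by (subst T[symmetric]) (simp add: nn_integral_distr)
  also have "\<dots> = (\<integral>\<^sup>+f. ?G (frame_map e (\<Sum>b\<in>Basis. f b *\<^sub>R b)) \<partial>PiM Basis (\<lambda>_. lborel))"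
    by (subst lborel_eq) (simp add: nn_integral_distr)
  also have "\<dots> = (\<integral>\<^sup>+f. ball_integrand Basis a p f \<partial>PiM Basis (\<lambda>_. lborel))"
  proof (intro nn_integral_cong)
    fix f :: "'a \<Rightarrow> real"
    have "ellipsoid_form Basis c (\<lambda>b. frame_map e (\<Sum>b\<in>Basis. f b *\<^sub>R b) \<bullet> e b) = ellipsoid_form Basis c f" for c
      by (simp add: ellipsoid_form_def frame_map_inner[OF e])
    then show "?G (frame_map e (\<Sum>b\<in>Basis. f b *\<^sub>R b)) = ball_integrand Basis a p f"
      by (simp add: ball_integrand_def indicator_def)
  qed
  finally have G_int: "(\<integral>\<^sup>+y. ?G y \<partial>lborel) = (\<integral>\<^sup>+f. ball_integrand Basis a p f \<partial>PiM Basis (\<lambda>_. lborel))" .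
  have "(\<integral>\<^sup>+x. ennreal (?Q x powr - (p / 2)) \<partial>sphere_measure) =
      of_nat DIM('a) * (\<integral>\<^sup>+y. ennreal (?Q (y /\<^sub>R norm y) powr - (p / 2)) * indicator (cball 0 1 - {0}) y \<partial>lborel)"
    by (rule nn_integral_sphere_measure) measurable
  then show ?thesis
    by (simp only: pointwise G_int)
qed

section \<open>Ellipsoids inside and around a convex body\<close>

text \<open>
  A Gram--Schmidt process with pivoting: each \<open>x k\<close> is a point of \<open>K\<close> at maximal distance from the
  span of its predecessors. This replaces the ellipsoid of John.
\<close>

lemma greedy_orthonormal_sequence:
  fixes K :: "'a::euclidean_space set"
  assumes K: "compact K" "0 \<in> K" "interior K \<noteq> {}" and k: "k \<le> DIM('a)"
  shows "\<exists>(x :: nat \<Rightarrow> 'a) e a.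
    (\<forall>i<k. x i \<in> K \<and> a i > 0 \<and> x i \<bullet> e i = a i \<and> x i = (\<Sum>j\<le>i. (x i \<bullet> e j) *\<^sub>R e j)) \<and>
    (\<forall>i<k. \<forall>j<k. e i \<bullet> e j = (if i = j then 1 else 0)) \<and>
    (\<forall>w\<in>K. \<forall>i<k. \<bar>w \<bullet> e i\<bar> \<le> a i)"
  using k
proof (induction k)
  case 0
  then show ?case by simp
next
  case (Suc k)
  then have "k \<le> DIM('a)"
    by simp
  from Suc.IH[OF this] obtain x :: "nat \<Rightarrow> 'a" and e a where
    x': "\<forall>i<k. x i \<in> K \<and> a i > 0 \<and> x i \<bullet> e i = a i \<and> x i = (\<Sum>j\<le>i. (x i \<bullet> e j) *\<^sub>R e j)"
    and e': "\<forall>i<k. \<forall>j<k. e i \<bullet> e j = (if i = j then 1 else 0)"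
    and bound': "\<forall>w\<in>K. \<forall>i<k. \<bar>w \<bullet> e i\<bar> \<le> a i"
    by blast
  have x: "x i \<in> K" "a i > 0" "x i \<bullet> e i = a i" "x i = (\<Sum>j\<le>i. (x i \<bullet> e j) *\<^sub>R e j)" if "i < k" for i
    using x' that by blast+
  have e: "e i \<bullet> e j = (if i = j then 1 else 0)" if "i < k" "j < k" for i j
    using e' that by blast
  have bound: "\<bar>w \<bullet> e i\<bar> \<le> a i" if "w \<in> K" "i < k" for w i
    using bound' that by blast
  \<comment> \<open>The component orthogonal to the span of the vectors found so far; its norm is
    the distance to that span, and \<open>y\<close> maximises it over \<open>K\<close>.\<close>
  define P where "P w = w - (\<Sum>j<k. (w \<bullet> e j) *\<^sub>R e j)" for w
  have "continuous_on K (\<lambda>w. norm (P w))"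
    unfolding P_def by (intro continuous_intros)
  then obtain y where y: "y \<in> K" "\<And>w. w \<in> K \<Longrightarrow> norm (P w) \<le> norm (P y)"
    using continuous_attains_sup[OF K(1), of "\<lambda>w. norm (P w)"] K(2) by blast
  have P_orth: "P w \<bullet> e i = 0" if "i < k" for w i
  proof -
    have "(\<Sum>j<k. (w \<bullet> e j) * (e j \<bullet> e i)) = (\<Sum>j<k. if j = i then w \<bullet> e j else 0)"
      using e that by (intro sum.cong) auto
    then show ?thesis
      using that by (simp add: P_def inner_diff_left inner_sum_left)
  qed
  \<comment> \<open>Distance zero would put \<open>K\<close> into a subspace of dimension at most
    \<open>k\<close>, less than the full dimension, contradicting the nonempty interior.\<close>
  have Py: "norm (P y) > 0"
  proof (rule ccontr)
    assume "\<not> norm (P y) > 0"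
    then have "P w = 0" if "w \<in> K" for w
      using y(2)[OF that] by (metis norm_le_zero_iff order.trans not_less)
    then have "w \<in> span (e ` {..<k})" if "w \<in> K" for w
    proof -
      have "w = (\<Sum>j<k. (w \<bullet> e j) *\<^sub>R e j)"
        using \<open>\<And>w. w \<in> K \<Longrightarrow> P w = 0\<close>[OF that] by (simp add: P_def)
      also have "\<dots> \<in> span (e ` {..<k})"
        by (intro span_sum span_scale span_base) auto
      finally show ?thesis .
    qed
    then have "dim K \<le> card (e ` {..<k})"
      by (intro dim_le_card) auto
    also have "\<dots> \<le> k"
      using card_image_le[of "{..<k}" e] by simp
    finally have "dim K < DIM('a)"
      using Suc.prems by simp
    then show False
      using K(3) empty_interior_lowdim by blast
  qed
  define d where "d = norm (P y)"
  define u where "u = P y /\<^sub>R d"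
  have d: "d > 0"
    using Py by (simp add: d_def)
  have u_e: "u \<bullet> e i = 0" if "i < k" for i
    using P_orth[OF that] by (simp add: u_def)
  have norm_u: "norm u = 1"
    using d by (simp add: u_def d_def)
  then have u_u: "u \<bullet> u = 1"
    by (simp add: norm_eq_1)
  have inner_u: "w \<bullet> u = P w \<bullet> u" for w
  proof -
    have "e j \<bullet> u = 0" if "j < k" for j
      using u_e[OF that] by (simp add: inner_commute)
    then have "(\<Sum>j<k. (w \<bullet> e j) *\<^sub>R e j) \<bullet> u = 0"
      by (simp add: inner_sum_left)
    then show ?thesis
      by (simp add: P_def inner_diff_left)
  qed
  have Py_u: "P y = d *\<^sub>R u"
    using d by (simp add: u_def)
  have y_u: "y \<bullet> u = d"
    using u_u by (simp add: inner_u[of y] Py_u)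
  have y_eq: "y = (\<Sum>j<k. (y \<bullet> e j) *\<^sub>R e j) + (y \<bullet> u) *\<^sub>R u"
    unfolding y_u Py_u[symmetric] by (simp add: P_def)
  \<comment> \<open>The pivoting pays off here: \<open>w\<close> pairs with \<open>u\<close> only
    through \<open>P w\<close>, whose norm is at most the maximum \<open>d\<close>.\<close>
  have bound_u: "\<bar>w \<bullet> u\<bar> \<le> d" if "w \<in> K" for w
  proof -
    have "\<bar>w \<bullet> u\<bar> \<le> norm (P w) * norm u"
      unfolding inner_u[of w] by (rule Cauchy_Schwarz_ineq2)
    then show ?thesis
      using y(2)[OF that] by (simp add: norm_u d_def)
  qed
  let ?x = "x(k := y)" and ?e = "e(k := u)" and ?a = "a(k := d)"
  have x_sum: "?x i = (\<Sum>j\<le>i. (?x i \<bullet> ?e j) *\<^sub>R ?e j)" if "i < Suc k" for i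
  proof (cases "i = k")
    case True
    have "(\<Sum>j\<le>k. (y \<bullet> ?e j) *\<^sub>R ?e j) = (\<Sum>j<k. (y \<bullet> ?e j) *\<^sub>R ?e j) + (y \<bullet> u) *\<^sub>R u"
      by (simp add: lessThan_Suc_atMost[symmetric])
    also have "(\<Sum>j<k. (y \<bullet> ?e j) *\<^sub>R ?e j) = (\<Sum>j<k. (y \<bullet> e j) *\<^sub>R e j)"
      by (intro sum.cong) auto
    finally show ?thesis
      using True y_eq by simp
  next
    case False
    then have i: "i < k"
      using that by simp
    have "(\<Sum>j\<le>i. (x i \<bullet> ?e j) *\<^sub>R ?e j) = (\<Sum>j\<le>i. (x i \<bullet> e j) *\<^sub>R e j)"
      using i by (intro sum.cong) auto
    then show ?thesis
      using x(4)[OF i] i by simp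
  qed
  have x_K: "?x i \<in> K" and a_pos: "?a i > 0" and x_diag: "?x i \<bullet> ?e i = ?a i" if "i < Suc k" for i
    using that x(1-3) y d y_u by (auto simp: less_Suc_eq)
  have e_orth: "?e i \<bullet> ?e j = (if i = j then 1 else 0)" if "i < Suc k" "j < Suc k" for i j
    using that e u_e u_u by (auto simp: less_Suc_eq inner_commute)
  have e_bound: "\<bar>w \<bullet> ?e i\<bar> \<le> ?a i" if "w \<in> K" "i < Suc k" for w i
    using that bound bound_u by (auto simp: less_Suc_eq)
  show ?case
    by (intro exI[of _ ?x] exI[of _ ?e] exI[of _ ?a] conjI allI impI ballI)
      (rule x_K a_pos x_diag x_sum e_orth e_bound; assumption)+
qed

text \<open>The missing weight is put on the point 0 of \<open>K\<close>.\<close>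

lemma convex_sum_le_1:
  fixes x :: "nat \<Rightarrow> 'a::real_vector"
  assumes K: "convex K" "0 \<in> K" and x: "\<And>i. i < N \<Longrightarrow> x i \<in> K"
    and u: "\<And>i. i < N \<Longrightarrow> 0 \<le> u i" "(\<Sum>i<N. u i) \<le> 1"
  shows "(\<Sum>i<N. u i *\<^sub>R x i) \<in> K"
proof -
  let ?u = "u(N := 1 - (\<Sum>i<N. u i))" and ?x = "x(N := 0)"
  have "sum ?u {..<Suc N} = 1"
    by simp
  then have "(\<Sum>i<Suc N. ?u i *\<^sub>R ?x i) \<in> K"
    using K x u by (intro convex_sum) (auto simp: less_Suc_eq)
  also have "(\<Sum>i<Suc N. ?u i *\<^sub>R ?x i) = (\<Sum>i<N. u i *\<^sub>R x i)"
    by simp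
  finally show ?thesis .
qed

text \<open>Forward substitution: the \<open>x i\<close> are triangular in the frame with diagonal
  \<open>a i\<close>, and the off-diagonal entries in column \<open>j\<close> are at most
  \<open>a j\<close>. The errors at worst double at each step, as M plus the sum of M 2^j over j < i
  equals M 2^i.\<close>

lemma triangular_bound:
  fixes x e :: "nat \<Rightarrow> 'a::real_inner" and a :: "nat \<Rightarrow> real"
  assumes x: "\<And>i. i < N \<Longrightarrow> a i > 0" "\<And>i. i < N \<Longrightarrow> x i \<bullet> e i = a i"
      "\<And>i. i < N \<Longrightarrow> x i = (\<Sum>j\<le>i. (x i \<bullet> e j) *\<^sub>R e j)"
    and coeff: "\<And>i j. i < N \<Longrightarrow> j < N \<Longrightarrow> \<bar>x i \<bullet> e j\<bar> \<le> a j"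
    and y: "\<And>i. i < N \<Longrightarrow> \<bar>y \<bullet> x i\<bar> \<le> M"
    and i: "i < N"
  shows "\<bar>y \<bullet> e i\<bar> * a i \<le> M * 2 ^ i"
  using i
proof (induction i rule: less_induct)
  case (less i)
  have "y \<bullet> x i = (\<Sum>j\<le>i. (x i \<bullet> e j) * (y \<bullet> e j))"
    using arg_cong[OF x(3)[OF less.prems], of "inner y"] by (simp add: inner_sum_right)
  also have "\<dots> = (\<Sum>j<i. (x i \<bullet> e j) * (y \<bullet> e j)) + a i * (y \<bullet> e i)"
    using x(2)[OF less.prems] by (simp add: lessThan_Suc_atMost[symmetric])
  finally have "a i * (y \<bullet> e i) = y \<bullet> x i - (\<Sum>j<i. (x i \<bullet> e j) * (y \<bullet> e j))"
    by simp
  then have "\<bar>a i * (y \<bullet> e i)\<bar> \<le> \<bar>y \<bullet> x i\<bar> + \<bar>\<Sum>j<i. (x i \<bullet> e j) * (y \<bullet> e j)\<bar>"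
    by linarith
  also have "\<dots> \<le> M + (\<Sum>j<i. M * 2 ^ j)"
  proof (intro add_mono y[OF less.prems] order.trans[OF sum_abs] sum_mono)
    fix j assume "j \<in> {..<i}"
    then have j: "j < i" "j < N"
      using less.prems by auto
    have "\<bar>(x i \<bullet> e j) * (y \<bullet> e j)\<bar> \<le> a j * \<bar>y \<bullet> e j\<bar>"
      unfolding abs_mult using coeff[OF less.prems j(2)] by (intro mult_right_mono) auto
    also have "\<dots> \<le> M * 2 ^ j"
      using less.IH[OF j] by (simp add: mult.commute)
    finally show "\<bar>(x i \<bullet> e j) * (y \<bullet> e j)\<bar> \<le> M * 2 ^ j" .
  qed
  also have "\<dots> = M * 2 ^ i"
  proof -
    have "(\<Sum>j<i. (2::real) ^ j) = 2 ^ i - 1"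
      by (induction i) auto
    moreover have "M + (\<Sum>j<i. M * 2 ^ j) = M * (1 + (\<Sum>j<i. 2 ^ j))"
      by (simp add: sum_distrib_left distrib_left)
    ultimately show ?thesis
      by simp
  qed
  finally show ?case
    using x(1)[OF less.prems] by (simp add: abs_mult mult.commute)
qed

text \<open>The factor DIM + 1 is the reciprocal of the weights defining the centre in
  \<open>convex_body_frame\<close>; the power of 2 is the loss in
  \<open>triangular_bound\<close>.\<close>

definition frame_const :: "'a::euclidean_space itself \<Rightarrow> real" where
  "frame_const _ = real (DIM('a) + 1) * 2 ^ DIM('a)"

lemma two_le_frame_const: "2 \<le> frame_const TYPE('a::euclidean_space)"
proof -
  have "(1::real) \<le> 2 ^ DIM('a)"
    by (rule one_le_power) simp
  moreover have "2 \<le> real (DIM('a) + 1)"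
    using DIM_positive[where 'a = 'a] by linarith
  ultimately have "2 * 1 \<le> real (DIM('a) + 1) * 2 ^ DIM('a)"
    by (intro mult_mono) auto
  then show ?thesis
    by (simp add: frame_const_def)
qed

text \<open>The centre is the centroid of the simplex spanned by a point of \<Omega> and the pivot
  points. From it one can move by a fixed fraction of each pivot vector in both directions, which
  bounds polar vectors on the pivots; \<open>triangular_bound\<close> transfers this to the
  frame.\<close>

proposition convex_body_frame:
  fixes \<Omega> :: "'a::euclidean_space set"
  assumes "\<Omega> \<in> convex_bodies"
  obtains z and e :: "'a \<Rightarrow> 'a" and a :: "'a \<Rightarrow> real" where
    "z \<in> interior \<Omega>" "orthonormal_frame e" "\<And>b. b \<in> Basis \<Longrightarrow> a b > 0"
    "\<And>w b. w \<in> \<Omega> \<Longrightarrow> b \<in> Basis \<Longrightarrow> \<bar>(w - z) \<bullet> e b\<bar> \<le> frame_const TYPE('a) * a b"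
    "\<And>y b. (\<And>w. w \<in> \<Omega> \<Longrightarrow> y \<bullet> (w - z) \<le> 1) \<Longrightarrow> b \<in> Basis \<Longrightarrow> \<bar>y \<bullet> e b\<bar> * a b \<le> frame_const TYPE('a)"
proof -
  let ?N = "DIM('a)"
  have \<Omega>: "compact \<Omega>" "convex \<Omega>" "interior \<Omega> \<noteq> {}"
    using assms by (auto simp: convex_bodies_def)
  obtain x0 where x0: "x0 \<in> \<Omega>"
    using \<Omega>(3) interior_subset by blast
  define K where "K = (\<lambda>w. - x0 + w) ` \<Omega>"
  have K: "compact K" "convex K" "0 \<in> K" "interior K \<noteq> {}"
    unfolding K_def interior_translation
    using \<Omega> x0 compact_translation[of \<Omega> "- x0"] convex_translation[of \<Omega> "- x0"] by auto
  have K_iff: "w \<in> K \<longleftrightarrow> x0 + w \<in> \<Omega>" for w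
    by (force simp: K_def image_iff)
  obtain x :: "nat \<Rightarrow> 'a" and e a where
    x': "\<forall>i<?N. x i \<in> K \<and> a i > 0 \<and> x i \<bullet> e i = a i \<and> x i = (\<Sum>j\<le>i. (x i \<bullet> e j) *\<^sub>R e j)"
    and e': "\<forall>i<?N. \<forall>j<?N. e i \<bullet> e j = (if i = j then 1 else 0)"
    and bound': "\<forall>w\<in>K. \<forall>i<?N. \<bar>w \<bullet> e i\<bar> \<le> a i"
    using greedy_orthonormal_sequence[OF K(1,3,4) order.refl] by blast
  have x: "x i \<in> K" "a i > 0" "x i \<bullet> e i = a i" "x i = (\<Sum>j\<le>i. (x i \<bullet> e j) *\<^sub>R e j)" if "i < ?N" for i
    using x' that by blast+
  have bound: "\<bar>w \<bullet> e i\<bar> \<le> a i" if "w \<in> K" "i < ?N" for w i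
    using bound' that by blast
  define c where "c = 1 / real (?N + 1)"
  have c: "c > 0" "real ?N * c + c = 1"
    by (auto simp: c_def field_simps)
  define z where "z = x0 + (\<Sum>i<?N. c *\<^sub>R x i)"
  have z_K: "z - x0 \<in> K"
    unfolding z_def using x c by (simp, intro convex_sum_le_1 K) auto
  \<comment> \<open>The shift changes the weight of \<open>x i\<close> from \<open>c\<close> to
    \<open>2 * c\<close> or 0, so the weights stay nonnegative and their sum stays at most
    \<open>real ?N * c + c = 1\<close>.\<close>
  have z_shift: "z + (d * c) *\<^sub>R x i \<in> \<Omega>" if i: "i < ?N" and d: "d = 1 \<or> d = -1" for i d
  proof -
    have "(\<Sum>j<?N. (c + (if j = i then d * c else 0)) *\<^sub>R x j) \<in> K"
      using x c i d by (intro convex_sum_le_1 K) (auto simp: sum.distrib)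
    also have "(\<Sum>j<?N. (c + (if j = i then d * c else 0)) *\<^sub>R x j) = (\<Sum>j<?N. c *\<^sub>R x j) + (d * c) *\<^sub>R x i"
      using i by (simp add: scaleR_add_left sum.distrib if_distrib[of "\<lambda>r. r *\<^sub>R _"] cong: if_cong)
    finally show ?thesis
      by (simp add: K_iff z_def add.assoc)
  qed
  \<comment> \<open>The factor 2 arises because the greedy bound holds relative to
    \<open>x0\<close>, and both \<open>w\<close> and \<open>z\<close> are compared with that
    point.\<close>
  have box: "\<bar>(w - z) \<bullet> e i\<bar> \<le> 2 * a i" if "w \<in> \<Omega>" "i < ?N" for w i
  proof -
    have "\<bar>(w - x0) \<bullet> e i\<bar> \<le> a i" "\<bar>(z - x0) \<bullet> e i\<bar> \<le> a i"
      using that z_K by (auto intro!: bound simp: K_iff)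
    then show ?thesis
      by (simp add: inner_diff_left)
  qed
  have polar: "\<bar>y \<bullet> e i\<bar> * a i \<le> frame_const TYPE('a)"
    if y: "\<And>w. w \<in> \<Omega> \<Longrightarrow> y \<bullet> (w - z) \<le> 1" and i: "i < ?N" for y i
  proof -
    have "\<bar>y \<bullet> x i\<bar> \<le> real (?N + 1)" if "i < ?N" for i
      using y[OF z_shift[OF that, of 1]] y[OF z_shift[OF that, of "-1"]]
      by (simp add: c_def field_simps abs_le_iff)
    then have "\<bar>y \<bullet> e i\<bar> * a i \<le> real (?N + 1) * 2 ^ i"
      using x bound i by (intro triangular_bound[where N = ?N and x = x]) auto
    also have "\<dots> \<le> frame_const TYPE('a)"
      unfolding frame_const_def using i by (intro mult_left_mono power_increasing) auto
    finally show ?thesis .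
  qed
  obtain h where h: "bij_betw h (Basis :: 'a set) {..<?N}"
    using ex_bij_betw_finite_nat[of "Basis :: 'a set"] by (auto simp: atLeast0LessThan)
  have h_less: "h b < ?N" if "b \<in> Basis" for b
    using bij_betwE[OF h] that by auto
  have frame: "orthonormal_frame (e \<circ> h)"
    unfolding orthonormal_frame_def using e' h_less bij_betw_imp_inj_on[OF h] by (auto simp: inj_on_eq_iff)
  have polar': "\<bar>y \<bullet> (e \<circ> h) b\<bar> * (a \<circ> h) b \<le> frame_const TYPE('a)"
    if "\<And>w. w \<in> \<Omega> \<Longrightarrow> y \<bullet> (w - z) \<le> 1" "b \<in> Basis" for y b
    using polar[OF that(1) h_less[OF that(2)]] by simp
  \<comment> \<open>A supporting hyperplane at \<open>z\<close> would make the polar body unbounded in the normal direction.\<close>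
  have z_interior: "z \<in> interior \<Omega>"
  proof (rule ccontr)
    assume "z \<notin> interior \<Omega>"
    then obtain v t where v: "v \<noteq> 0" "\<forall>w\<in>interior \<Omega>. v \<bullet> w \<le> t" "v \<bullet> z \<ge> t"
      using separating_hyperplane_sets[of "interior \<Omega>" "{z}"] \<Omega> by (auto simp: convex_interior)
    \<comment> \<open>The hyperplane separates \<open>z\<close> only from the interior; the
      inequality reaches all of \<Omega> because a convex set with interior points lies in the
      closure of its interior.\<close>
    have "closure (interior \<Omega>) \<subseteq> {w. v \<bullet> w \<le> t}"
      using v(2) by (intro closure_minimal closed_halfspace_le) auto
    moreover have "\<Omega> \<subseteq> closure (interior \<Omega>)"
      using convex_closure_interior[OF \<Omega>(2,3)] closure_subset by blast
    ultimately have v_le: "v \<bullet> (w - z) \<le> 0" if "w \<in> \<Omega>" for w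
      using that v(3) by (auto simp: inner_diff_right)
    have v_e: "v \<bullet> (e \<circ> h) b = 0" if b: "b \<in> Basis" for b
    proof (rule ccontr)
      assume "v \<bullet> (e \<circ> h) b \<noteq> 0"
      then have "\<bar>v \<bullet> (e \<circ> h) b\<bar> * (a \<circ> h) b > 0"
        using x(2)[OF h_less[OF b]] by simp
      then obtain n :: nat where n: "real n * (\<bar>v \<bullet> (e \<circ> h) b\<bar> * (a \<circ> h) b) > frame_const TYPE('a)"
        using reals_Archimedean3 by blast
      have "(real n *\<^sub>R v) \<bullet> (w - z) \<le> 1" if "w \<in> \<Omega>" for w
        using mult_nonneg_nonpos[OF of_nat_0_le_iff v_le[OF that], of n] by simp
      from polar'[OF this b] n show False
        by (simp add: abs_mult mult.assoc)
    qed
    obtain v' where v': "v = frame_map (e \<circ> h) v'"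
      using orthogonal_transformation_surj[OF orthogonal_transformation_frame_map[OF frame]] by (metis surjD)
    have "v' \<bullet> b = 0" if "b \<in> Basis" for b
      using v_e[OF that] frame_map_inner[OF frame that, of v'] by (simp only: v')
    then have "v' = 0"
      by (simp add: euclidean_eq_iff[of v'])
    then show False
      using v(1) by (simp add: v' frame_map_def)
  qed
  have box': "\<bar>(w - z) \<bullet> (e \<circ> h) b\<bar> \<le> frame_const TYPE('a) * (a \<circ> h) b" if "w \<in> \<Omega>" "b \<in> Basis" for w b
  proof -
    have "2 * a (h b) \<le> frame_const TYPE('a) * a (h b)"
      using x(2)[OF h_less[OF that(2)]] two_le_frame_const[where 'a = 'a] by (intro mult_right_mono) auto
    then show ?thesis
      using box[OF that(1) h_less[OF that(2)]] by simp
  qed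
  have a_pos: "(a \<circ> h) b > 0" if "b \<in> Basis" for b
    using x(2)[OF h_less[OF that]] by simp
  from z_interior frame a_pos box' polar' show ?thesis
    by (rule that)
qed

section \<open>Radial functions\<close>

text \<open>A box with half-sides \<open>M * a b\<close> lies in the ellipsoid with half-axes
  \<open>a b\<close> enlarged by \<open>sqrt (real DIM('a)) * M\<close>. The assumption
  \<open>nonempty\<close> ensures that the supremum is not taken over the empty set.\<close>

lemma radial_le_ellipsoid:
  fixes S :: "'a::euclidean_space set"
  assumes e: "orthonormal_frame e" and a: "\<And>b. b \<in> Basis \<Longrightarrow> a b > 0" and M: "M > 0"
    and box: "\<And>w b. w \<in> S \<Longrightarrow> b \<in> Basis \<Longrightarrow> \<bar>(w - z) \<bullet> e b\<bar> \<le> M * a b"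
    and nonempty: "\<exists>t>0. t *\<^sub>R x + z \<in> S" and x: "norm x = 1"
  shows "0 \<le> radial S z x"
    and "radial S z x \<le> sqrt (real DIM('a)) * M * ellipsoid_form Basis a (\<lambda>b. x \<bullet> e b) powr - (1 / 2)"
proof -
  let ?Q = "ellipsoid_form Basis a (\<lambda>b. x \<bullet> e b)"
  let ?T = "{t. t > 0 \<and> t *\<^sub>R x + z \<in> S}"
  have Q: "?Q > 0"
  proof (rule ccontr)
    assume "\<not> ?Q > 0"
    then have "?Q = 0"
      using ellipsoid_form_nonneg[of Basis a "\<lambda>b. x \<bullet> e b"] by simp
    then have "(x \<bullet> e b / a b)\<^sup>2 = 0" if "b \<in> Basis" for b
      using component_le_ellipsoid_form[of Basis b "\<lambda>b. x \<bullet> e b" a] that by simp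
    then have "x \<bullet> e b = 0" if "b \<in> Basis" for b
      using a[OF that] that by force
    then have "ellipsoid_form Basis (\<lambda>_. 1) (\<lambda>b. x \<bullet> e b) = 0"
      by (simp add: ellipsoid_form_def)
    then show False
      using x by (simp add: ellipsoid_form_frame_1[OF e])
  qed
  have upper: "t \<le> sqrt (real DIM('a)) * M * ?Q powr - (1 / 2)" if "t \<in> ?T" for t
  proof -
    have t: "t > 0" "t *\<^sub>R x + z \<in> S"
      using that by auto
    have "t\<^sup>2 * ?Q = (\<Sum>b\<in>Basis. (t * (x \<bullet> e b) / a b)\<^sup>2)"
      using ellipsoid_form_scale[of Basis a t "\<lambda>b. x \<bullet> e b"] by (simp add: ellipsoid_form_def)
    also have "\<dots> \<le> (\<Sum>b\<in>(Basis :: 'a set). M\<^sup>2)"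
    proof (intro sum_mono)
      fix b :: 'a assume b: "b \<in> Basis"
      have "\<bar>t * (x \<bullet> e b)\<bar> \<le> M * a b"
        using box[OF t(2) b] by simp
      then have "\<bar>t * (x \<bullet> e b) / a b\<bar> \<le> \<bar>M\<bar>"
        using a[OF b] M by (simp add: abs_div divide_le_eq)
      then show "(t * (x \<bullet> e b) / a b)\<^sup>2 \<le> M\<^sup>2"
        by (simp only: abs_le_square_iff)
    qed
    finally have "(t * sqrt ?Q)\<^sup>2 \<le> (sqrt (real DIM('a)) * M)\<^sup>2"
      using Q by (simp add: power_mult_distrib)
    then have "t * sqrt ?Q \<le> sqrt (real DIM('a)) * M"
      using M by (intro power2_le_imp_le[of "t * sqrt ?Q"]) auto
    then have "t \<le> sqrt (real DIM('a)) * M / sqrt ?Q"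
      using Q by (simp add: pos_le_divide_eq)
    also have "\<dots> = sqrt (real DIM('a)) * M * ?Q powr - (1 / 2)"
      using Q by (simp add: powr_minus_divide powr_half_sqrt)
    finally show ?thesis .
  qed
  have ne: "?T \<noteq> {}"
    using nonempty by blast
  then show "radial S z x \<le> sqrt (real DIM('a)) * M * ?Q powr - (1 / 2)"
    unfolding radial_def using upper by (rule cSup_least)
  obtain t where t: "t \<in> ?T"
    using ne by blast
  have "t \<le> Sup ?T"
    using t upper by (intro cSup_upper bdd_aboveI)
  then show "0 \<le> radial S z x"
    using t by (simp add: radial_def)
qed

text \<open>The Bochner integral of a non-integrable or non-measurable function is \<open>0\<close>.\<close>

lemma integral_le_of_nn_integral_le:
  fixes f :: "'a \<Rightarrow> real"
  assumes "\<And>x. x \<in> space M \<Longrightarrow> 0 \<le> f x" "(\<integral>\<^sup>+x. ennreal (f x) \<partial>M) \<le> ennreal B" "0 \<le> B"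
  shows "(LINT x|M. f x) \<le> B"
proof (cases "integrable M f")
  case True
  then have "ennreal (LINT x|M. f x) = (\<integral>\<^sup>+x. ennreal (f x) \<partial>M)"
    using assms(1) by (intro nn_integral_eq_integral[symmetric] AE_I2)
  also note assms(2)
  finally show ?thesis
    by (simp only: ennreal_le_iff[OF assms(3)])
next
  case False
  then show ?thesis
    using assms(3) by (simp add: not_integrable_integral_eq)
qed

text \<open>The comparison is made between nonnegative integrals, where
  \<open>nn_integral_mono\<close> holds for arbitrary functions, and is carried over to the Bochner
  integral only at the end.\<close>

lemma integral_radial_powr_le:
  fixes S :: "'a::euclidean_space set"
  assumes e: "orthonormal_frame e" and a: "\<And>b. b \<in> Basis \<Longrightarrow> a b > 0" and M: "M > 0"
    and box: "\<And>w b. w \<in> S \<Longrightarrow> b \<in> Basis \<Longrightarrow> \<bar>(w - z) \<bullet> e b\<bar> \<le> M * a b"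
    and nonempty: "\<And>x. norm x = 1 \<Longrightarrow> \<exists>t>0. t *\<^sub>R x + z \<in> S"
    and p: "p > 0" and B: "B \<ge> 0"
    and le: "(\<integral>\<^sup>+f. ball_integrand Basis a p f \<partial>PiM Basis (\<lambda>_. lborel)) \<le> ennreal B"
  shows "(LINT x|sphere_measure. radial S z x powr p) \<le>
    (sqrt (real DIM('a)) * M) powr p * real DIM('a) * B"
proof (rule integral_le_of_nn_integral_le)
  let ?c = "(sqrt (real DIM('a)) * M) powr p"
  have "(\<integral>\<^sup>+x. ennreal (radial S z x powr p) \<partial>sphere_measure) \<le>
      (\<integral>\<^sup>+x. ennreal ?c * ennreal (ellipsoid_form Basis a (\<lambda>b. x \<bullet> e b) powr - (p / 2)) \<partial>sphere_measure)"
  proof (intro nn_integral_mono)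
    fix x :: 'a assume "x \<in> space sphere_measure"
    then have x: "norm x = 1"
      by (simp add: space_sphere_measure)
    note r = radial_le_ellipsoid[OF e a M box nonempty[OF x] x]
    have "radial S z x powr p \<le>
        (sqrt (real DIM('a)) * M * ellipsoid_form Basis a (\<lambda>b. x \<bullet> e b) powr - (1 / 2)) powr p"
      using r p by (intro powr_mono2) auto
    also have "\<dots> = ?c * ellipsoid_form Basis a (\<lambda>b. x \<bullet> e b) powr - (p / 2)"
      using M by (simp add: powr_mult powr_powr)
    finally show "ennreal (radial S z x powr p) \<le>
        ennreal ?c * ennreal (ellipsoid_form Basis a (\<lambda>b. x \<bullet> e b) powr - (p / 2))"
      by (simp add: ennreal_leI flip: ennreal_mult')
  qed
  also have "\<dots> = ennreal ?c * (\<integral>\<^sup>+x. ennreal (ellipsoid_form Basis a (\<lambda>b. x \<bullet> e b) powr - (p / 2)) \<partial>sphere_measure)"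
  proof (rule nn_integral_cmult)
    show "(\<lambda>x. ennreal (ellipsoid_form Basis a (\<lambda>b. x \<bullet> e b) powr - (p / 2))) \<in> borel_measurable sphere_measure"
      by (subst measurable_cong_sets[OF sets_sphere_measure refl], rule measurable_restrict_space1) measurable
  qed
  also have "\<dots> = ennreal ?c * (of_nat DIM('a) * (\<integral>\<^sup>+f. ball_integrand Basis a p f \<partial>PiM Basis (\<lambda>_. lborel)))"
    by (simp only: nn_integral_sphere_ellipsoid[OF e])
  also have "\<dots> \<le> ennreal ?c * (of_nat DIM('a) * ennreal B)"
    by (intro mult_left_mono le) auto
  also have "\<dots> = ennreal (?c * real DIM('a) * B)"
    using B by (simp add: ennreal_mult mult.assoc ennreal_of_nat_eq_real_of_nat)
  finally show "(\<integral>\<^sup>+x. ennreal (radial S z x powr p) \<partial>sphere_measure) \<le> ennreal (?c * real DIM('a) * B)" .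
qed (use B in auto)

section \<open>Rays in the body and its dual, and the final estimate\<close>

lemma convex_body_ray:
  fixes \<Omega> :: "'a::euclidean_space set"
  assumes "z \<in> interior \<Omega>" "norm x = 1"
  shows "\<exists>t>0. t *\<^sub>R x + z \<in> \<Omega>"
proof -
  obtain r where "r > 0" "cball z r \<subseteq> \<Omega>"
    using assms(1) by (auto simp: mem_interior_cball)
  moreover have "r *\<^sub>R x + z \<in> cball z r"
    using assms(2) \<open>r > 0\<close> by (simp add: dist_norm)
  ultimately show ?thesis
    by blast
qed

text \<open>By Cauchy-Schwarz, a body inside the ball of radius \<open>r\<close> about
  \<open>z\<close> has a dual containing all points at distance \<open>1 / r\<close> from
  \<open>z\<close>.\<close>

lemma dual_body_ray:
  fixes \<Omega> :: "'a::euclidean_space set"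
  assumes "bounded \<Omega>" "norm x = 1"
  shows "\<exists>t>0. t *\<^sub>R x + z \<in> dual_body \<Omega> z"
proof -
  obtain r where "r > 0" "\<Omega> \<subseteq> ball z r"
    using bounded_subset_ballD[OF assms(1)] by blast
  then have r: "r > 0" "\<And>w. w \<in> \<Omega> \<Longrightarrow> norm (w - z) \<le> r"
    by (auto simp: dist_norm norm_minus_commute subset_eq less_imp_le)
  have "(1 / r) *\<^sub>R x \<bullet> (w - z) \<le> 1" if "w \<in> \<Omega>" for w
  proof -
    have "x \<bullet> (w - z) \<le> norm x * norm (w - z)"
      by (rule norm_cauchy_schwarz)
    also have "\<dots> \<le> r"
      using r(2)[OF that] assms(2) by simp
    finally show ?thesis
      using r(1) by (simp add: divide_le_eq)
  qed
  then show ?thesis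
    using r(1) by (intro exI[of _ "1 / r"]) (auto simp: dual_body_def)
qed

text \<open>The type \<open>'n\<close> carries the dimension n + 1. Supremum and infimum are taken
  in \<open>ereal\<close>, so a bound by a real number really asserts finiteness.\<close>

theorem theorem1p1:
  fixes n :: nat and \<alpha> \<beta> :: real
  assumes "n \<ge> 1" and "CARD('n::finite) = n + 1"
    and "\<alpha> > 0" and "\<beta> > 0"
    and "real n / \<alpha> + 1 / \<beta> \<ge> 1" and "1 / \<alpha> + real n / \<beta> \<ge> 1"
  shows "\<exists>C::real.
    (SUP \<Omega> \<in> (convex_bodies :: (real ^ 'n) set set). INF z \<in> interior \<Omega>.
      ereal ((LINT x|sphere_measure. radial \<Omega> z x powr \<alpha>) powr (1 / \<alpha>) *
             (LINT x|sphere_measure. radial (dual_body \<Omega> z) z x powr \<beta>) powr (1 / \<beta>)))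
    \<le> ereal C"
proof -
  let ?B = "Basis :: (real ^ 'n) set"
  define N where "N = real DIM(real ^ 'n)"
  define M where "M = frame_const TYPE(real ^ 'n)"
  have M: "M > 0"
    using two_le_frame_const[where 'a = "real ^ 'n"] by (simp add: M_def)
  have "card ?B = n + 1"
    using assms(2) by simp
  from ball_integral_product_bound[OF finite_Basis this assms(1,3-6)]
  obtain C where C: "C \<ge> 0" "\<And>a. \<forall>i\<in>?B. a i > 0 \<Longrightarrow> \<exists>R>0.
      (\<integral>\<^sup>+f. ball_integrand ?B a \<alpha> f \<partial>PiM ?B (\<lambda>_. lborel)) \<le> ennreal (C * R powr \<alpha>) \<and>
      (\<integral>\<^sup>+f. ball_integrand ?B (\<lambda>i. 1 / a i) \<beta> f \<partial>PiM ?B (\<lambda>_. lborel)) \<le> ennreal (C * R powr - \<beta>)"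
    by blast
  define C1 where "C1 p = (sqrt N * M) powr p * N * C" for p
  have C1: "C1 p \<ge> 0" for p
    using C(1) by (simp add: C1_def N_def)
  let ?C = "C1 \<alpha> powr (1 / \<alpha>) * C1 \<beta> powr (1 / \<beta>)"
  have "(INF z \<in> interior \<Omega>.
      ereal ((LINT x|sphere_measure. radial \<Omega> z x powr \<alpha>) powr (1 / \<alpha>) *
             (LINT x|sphere_measure. radial (dual_body \<Omega> z) z x powr \<beta>) powr (1 / \<beta>))) \<le> ereal ?C"
    if \<Omega>: "\<Omega> \<in> convex_bodies" for \<Omega> :: "(real ^ 'n) set"
  proof -
    obtain z and e :: "real ^ 'n \<Rightarrow> real ^ 'n" and a where
      z: "z \<in> interior \<Omega>" and e: "orthonormal_frame e" and a: "\<And>b. b \<in> ?B \<Longrightarrow> a b > 0"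
      and box: "\<And>w b. w \<in> \<Omega> \<Longrightarrow> b \<in> ?B \<Longrightarrow> \<bar>(w - z) \<bullet> e b\<bar> \<le> M * a b"
      and polar: "\<And>y b. (\<And>w. w \<in> \<Omega> \<Longrightarrow> y \<bullet> (w - z) \<le> 1) \<Longrightarrow> b \<in> ?B \<Longrightarrow> \<bar>y \<bullet> e b\<bar> * a b \<le> M"
      using convex_body_frame[OF \<Omega>] unfolding M_def by metis
    obtain R where R: "R > 0"
      "(\<integral>\<^sup>+f. ball_integrand ?B a \<alpha> f \<partial>PiM ?B (\<lambda>_. lborel)) \<le> ennreal (C * R powr \<alpha>)"
      "(\<integral>\<^sup>+f. ball_integrand ?B (\<lambda>i. 1 / a i) \<beta> f \<partial>PiM ?B (\<lambda>_. lborel)) \<le> ennreal (C * R powr - \<beta>)"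
      using C(2)[of a] a by blast
    have "bounded \<Omega>"
      using \<Omega> by (simp add: convex_bodies_def compact_imp_bounded)
    \<comment> \<open>The polar estimate says that the dual body lies in the box with the reciprocal
      half-axes, so the radial estimate applies to it with \<open>1 / a\<close>.\<close>
    have polar_box: "\<bar>(w - z) \<bullet> e b\<bar> \<le> M * (1 / a b)" if "w \<in> dual_body \<Omega> z" "b \<in> ?B" for w b
    proof -
      have "\<bar>(w - z) \<bullet> e b\<bar> * a b \<le> M"
        using that by (intro polar) (auto simp: dual_body_def)
      then show ?thesis
        using a[OF that(2)] by (simp add: field_simps)
    qed
    have "(LINT x|sphere_measure. radial \<Omega> z x powr \<alpha>) \<le> (sqrt N * M) powr \<alpha> * N * (C * R powr \<alpha>)"
      unfolding N_def using C(1) R(2) assms(3) convex_body_ray[OF z]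
      by (intro integral_radial_powr_le[OF e a M box]) auto
    also have "\<dots> = C1 \<alpha> * R powr \<alpha>"
      by (simp add: C1_def)
    finally have "(LINT x|sphere_measure. radial \<Omega> z x powr \<alpha>) powr (1 / \<alpha>) \<le> (C1 \<alpha> * R powr \<alpha>) powr (1 / \<alpha>)"
      using assms(3) by (intro powr_mono2 Bochner_Integration.integral_nonneg) auto
    also have "\<dots> = C1 \<alpha> powr (1 / \<alpha>) * R"
      using C1 R(1) assms(3) by (simp add: powr_mult powr_powr)
    finally have 1: "(LINT x|sphere_measure. radial \<Omega> z x powr \<alpha>) powr (1 / \<alpha>) \<le> C1 \<alpha> powr (1 / \<alpha>) * R" .
    have "(LINT x|sphere_measure. radial (dual_body \<Omega> z) z x powr \<beta>) \<le>
        (sqrt N * M) powr \<beta> * N * (C * R powr - \<beta>)"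
      unfolding N_def using C(1) R(3) assms(4) dual_body_ray[OF \<open>bounded \<Omega>\<close>] a
      by (intro integral_radial_powr_le[OF e _ M polar_box]) auto
    also have "\<dots> = C1 \<beta> * R powr - \<beta>"
      by (simp add: C1_def)
    finally have "(LINT x|sphere_measure. radial (dual_body \<Omega> z) z x powr \<beta>) powr (1 / \<beta>) \<le>
        (C1 \<beta> * R powr - \<beta>) powr (1 / \<beta>)"
      using assms(4) by (intro powr_mono2 Bochner_Integration.integral_nonneg) auto
    also have "\<dots> = C1 \<beta> powr (1 / \<beta>) * (1 / R)"
      using C1 R(1) assms(4) by (simp add: powr_mult powr_powr)
    finally have 2: "(LINT x|sphere_measure. radial (dual_body \<Omega> z) z x powr \<beta>) powr (1 / \<beta>) \<le>
        C1 \<beta> powr (1 / \<beta>) * (1 / R)" .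
    \<comment> \<open>After the roots the first factor carries \<open>R\<close> and the second
      \<open>1 / R\<close>; their cancellation leaves a bound independent of \<Omega>.\<close>
    have "(LINT x|sphere_measure. radial \<Omega> z x powr \<alpha>) powr (1 / \<alpha>) *
        (LINT x|sphere_measure. radial (dual_body \<Omega> z) z x powr \<beta>) powr (1 / \<beta>) \<le>
        (C1 \<alpha> powr (1 / \<alpha>) * R) * (C1 \<beta> powr (1 / \<beta>) * (1 / R))"
      using R(1) by (intro mult_mono 1 2) auto
    also have "\<dots> = ?C"
      using R(1) by simp
    finally show ?thesis
      using z by (intro INF_lower2[of z]) auto
  qed
  then show ?thesis
    by (intro exI[of _ ?C] SUP_least)
qed

end
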